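(* Let $X$ be a metric space, let $\mu$ be a measure over $X$, let $\alpha>0$ and fix $A\subset X$. Assume: (1) $\mu$ is both a regular measure and a Borel measure. (2) $\mathcal F_{\mu,\zeta_\alpha}$ covers $A$ finely. (3) $A$ is a Borel set. (4) $A$ has a countable covering whose elements are open and have finite $\mu$-measure. (5) The subset $\{x\in A:\mathfrak d^\alpha(\mu,x)=0\}$ is $\sigma$-finite with respect to $\mathcal H^\alpha$. (6) $\mu\llcorner A\ll\mathcal H^\alpha\llcorner A$. Then $\mathfrak d^\alpha(\mu,\cdot):A\to[0,+\infty]$ is Borel and for every Borel set $B\subset A$ we have $$\mu(B)=\int_B\mathfrak d^\alpha(\mu,x)\,d\mathcal H^\alpha(x).$$
   Context: A "measure over $X$" is an outer measure defined on all subsets of $X$; measurability is in the sense of Carathéodory, and integrals are with respect to the restriction of the outer measure to its measurable sets. A measure $\mu$ over $X$ is regular if every $E\subset X$ is contained in a $\mu$-measurable set $E'$ with $\mu(E')=\mu(E)$; it is a Borel measure if all Borel sets are $\mu$-measurable. A set is $\sigma$-finite with respect to a measure over $X$ if it is covered by countably many sets of finite measure. $(\mu\llcorner A)(E)=\mu(A\cap E)$, and $\mu\llcorner A\ll\psi\llcorner A$ means that $\mu(N)=0$ for every $N\subset A$ with $\psi(N)=0$. $\mathcal F$ is the family of all closed subsets of $X$, $c_\alpha>0$ is a fixed constant, and $\zeta_\alpha:\mathcal F\to[0,+\infty]$ is $\zeta_\alpha(S)=c_\alpha\operatorname{diam}(S)^\alpha$ (with $\operatorname{diam}(\emptyset)=0$).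 The $\alpha$-dimensional Hausdorff measure is $$\mathcal H^\alpha(R)=\sup_{\delta>0}\inf\Big\{\sum_{j=0}^\infty\zeta_\alpha(E_j): E_j\in\mathcal F,\ \operatorname{diam}(E_j)\le\delta,\ R\subset\bigcup_jE_j\Big\}\qquad(\inf\emptyset=+\infty).$$ $\mathcal F_{\mu,\zeta_\alpha}=\mathcal F\setminus\{S\in\mathcal F:\ \zeta_\alpha(S)=\mu(S)=0\ \text{or}\ \mu(S)=\zeta_\alpha(S)=+\infty\}$. A family $\mathcal G\subset\mathcal P(X)$ covers $A$ finely if for every $a\in A$ and $\epsilon>0$ there is $S\in\mathcal G$ with $a\in S$ and $\operatorname{diam}(S)<\epsilon$. The quotient function $Q_{\mu,\zeta_\alpha}:\mathcal F_{\mu,\zeta_\alpha}\to[0,+\infty]$ is $Q_{\mu,\zeta_\alpha}(S)=+\infty$ if $\zeta_\alpha(S)=0$, $Q_{\mu,\zeta_\alpha}(S)=\mu(S)/\zeta_\alpha(S)$ if $0<\zeta_\alpha(S)<+\infty$, and $Q_{\mu,\zeta_\alpha}(S)=0$ if $\zeta_\alpha(S)=+\infty$. For $x\in A$ the Federer density is $$\mathfrak d^\alpha(\mu,x)=\inf_{\epsilon>0}\sup\{Q_{\mu,\zeta_\alpha}(S): S\in\mathcal F_{\mu,\zeta_\alpha},\ x\in S,\ \operatorname{diam}(S)<\epsilon\}.$$ *)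

theory Defs
  imports "HOL-Analysis.Analysis"
begin

section \<open>Measures over a space (outer measures on all subsets)\<close>

definition measure_over :: "('a set \<Rightarrow> ennreal) \<Rightarrow> bool" where
  "measure_over \<mu> \<longleftrightarrow> outer_measure_space UNIV \<mu>"

definition caratheodory_sets :: "('a set \<Rightarrow> ennreal) \<Rightarrow> 'a set set" where
  "caratheodory_sets \<mu> = lambda_system UNIV UNIV \<mu>"

definition caratheodory_measure :: "('a set \<Rightarrow> ennreal) \<Rightarrow> 'a measure" where
  "caratheodory_measure \<mu> = measure_of UNIV (caratheodory_sets \<mu>) \<mu>"

text \<open>The type of measures is total: \<^const>\<open>measure_of\<close> yields the null measure if its third
  argument is not a measure on the given sets.  The following facts say that this does not happen.\<close>

lemma measure_space_caratheodory_sets: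
  assumes "measure_over \<mu>"
  shows "measure_space UNIV (caratheodory_sets \<mu>) \<mu>"
proof -
  interpret sigma_algebra UNIV "UNIV :: 'a set set"
    using sigma_algebra_Pow[of "UNIV :: 'a set"] by simp
  show ?thesis
    using caratheodory_lemma[of \<mu>] assms by (simp add: measure_over_def caratheodory_sets_def)
qed

lemma
  assumes "measure_over \<mu>"
  shows space_caratheodory_measure: "space (caratheodory_measure \<mu>) = UNIV"
    and sets_caratheodory_measure: "sets (caratheodory_measure \<mu>) = caratheodory_sets \<mu>"
    and emeasure_caratheodory_measure:
      "E \<in> caratheodory_sets \<mu> \<Longrightarrow> emeasure (caratheodory_measure \<mu>) E = \<mu> E"
proof -
  have ms: "measure_space UNIV (caratheodory_sets \<mu>) \<mu>"
    by (rule measure_space_caratheodory_sets[OF assms])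
  then interpret sigma_algebra UNIV "caratheodory_sets \<mu>"
    by (simp add: measure_space_def)
  show "space (caratheodory_measure \<mu>) = UNIV"
    by (simp add: caratheodory_measure_def space_measure_of_conv)
  show sets: "sets (caratheodory_measure \<mu>) = caratheodory_sets \<mu>"
    by (simp add: caratheodory_measure_def sets_measure_of_conv sigma_sets_eq)
  show "emeasure (caratheodory_measure \<mu>) E = \<mu> E" if "E \<in> caratheodory_sets \<mu>"
    unfolding caratheodory_measure_def
    by (rule emeasure_measure_of_sigma) (use ms that in \<open>auto simp: measure_space_def\<close>)
qed

definition regular_measure :: "('a set \<Rightarrow> ennreal) \<Rightarrow> bool" where
  "regular_measure \<mu> \<longleftrightarrow> (\<forall>E. \<exists>E'\<in>caratheodory_sets \<mu>. E \<subseteq> E' \<and> \<mu> E' = \<mu> E)"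

definition borel_measure :: "('a::topological_space set \<Rightarrow> ennreal) \<Rightarrow> bool" where
  "borel_measure \<mu> \<longleftrightarrow> sets borel \<subseteq> caratheodory_sets \<mu>"

definition sigma_finite_wrt :: "('a set \<Rightarrow> ennreal) \<Rightarrow> 'a set \<Rightarrow> bool" where
  "sigma_finite_wrt \<psi> S \<longleftrightarrow>
    (\<exists>\<E>. countable \<E> \<and> S \<subseteq> \<Union>\<E> \<and> (\<forall>E\<in>\<E>. \<psi> E < \<infinity>))"

text \<open>\<open>abs_continuous_on A \<mu> \<psi>\<close> means that the restriction of \<open>\<mu>\<close> to \<open>A\<close> is absolutely continuous
  with respect to the restriction of \<open>\<psi>\<close> to \<open>A\<close>.\<close>

definition abs_continuous_on :: "'a set \<Rightarrow> ('a set \<Rightarrow> ennreal) \<Rightarrow> ('a set \<Rightarrow> ennreal) \<Rightarrow> bool" where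
  "abs_continuous_on A \<mu> \<psi> \<longleftrightarrow> (\<forall>N. N \<subseteq> A \<and> \<psi> N = 0 \<longrightarrow> \<mu> N = 0)"


section \<open>Diameter, size function and Hausdorff measure\<close>

text \<open>The library's real-valued \<^const>\<open>diameter\<close> is 0 on unbounded sets; here they have diameter
  \<open>\<infinity>\<close>.  The supremum over the empty set is 0, so the empty set has diameter 0.\<close>

definition ediam :: "'a::metric_space set \<Rightarrow> ennreal" where
  "ediam S = (SUP (x, y)\<in>S \<times> S. ennreal (dist x y))"

text \<open>\<open>zeta c \<alpha> S\<close> is \<open>c * (diam S) ^ \<alpha>\<close>, for \<open>c > 0\<close> and \<open>\<alpha> > 0\<close>.\<close>

definition zeta :: "real \<Rightarrow> real \<Rightarrow> 'a::metric_space set \<Rightarrow> ennreal" where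
  "zeta c \<alpha> S = (if ediam S = \<infinity> then \<infinity> else ennreal (c * enn2real (ediam S) powr \<alpha>))"

definition hausdorff_measure :: "real \<Rightarrow> real \<Rightarrow> 'a::metric_space set \<Rightarrow> ennreal" where
  "hausdorff_measure c \<alpha> R =
    (SUP \<delta>\<in>{0<..}. INF E\<in>{E :: nat \<Rightarrow> 'a set.
        (\<forall>j. closed (E j) \<and> ediam (E j) \<le> ennreal \<delta>) \<and> R \<subseteq> (\<Union>j. E j)}.
      \<Sum>j. zeta c \<alpha> (E j))"


section \<open>Federer density\<close>

definition covers_finely :: "'a::metric_space set set \<Rightarrow> 'a set \<Rightarrow> bool" where
  "covers_finely \<G> A \<longleftrightarrow> (\<forall>a\<in>A. \<forall>\<epsilon>::real. 0 < \<epsilon> \<longrightarrow> (\<exists>S\<in>\<G>. a \<in> S \<and> ediam S < ennreal \<epsilon>))"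

definition closed_family ::
    "('a::metric_space set \<Rightarrow> ennreal) \<Rightarrow> ('a set \<Rightarrow> ennreal) \<Rightarrow> 'a set set" where
  "closed_family \<mu> \<zeta> = {S. closed S} -
    {S. closed S \<and> ((\<zeta> S = 0 \<and> \<mu> S = 0) \<or> (\<mu> S = \<infinity> \<and> \<zeta> S = \<infinity>))}"

text \<open>Only the values on \<^term>\<open>closed_family \<mu> \<zeta>\<close> matter.\<close>

definition quotient_fun ::
    "('a set \<Rightarrow> ennreal) \<Rightarrow> ('a set \<Rightarrow> ennreal) \<Rightarrow> 'a set \<Rightarrow> ennreal" where
  "quotient_fun \<mu> \<zeta> S =
    (if \<zeta> S = 0 then \<infinity> else if \<zeta> S < \<infinity> then \<mu> S / \<zeta> S else 0)"

definition federer_density ::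
    "real \<Rightarrow> real \<Rightarrow> ('a::metric_space set \<Rightarrow> ennreal) \<Rightarrow> 'a \<Rightarrow> ennreal" where
  "federer_density c \<alpha> \<mu> x =
    (INF \<epsilon>\<in>{0::real<..}. SUP S\<in>{S \<in> closed_family \<mu> (zeta c \<alpha>). x \<in> S \<and> ediam S < ennreal \<epsilon>}.
      quotient_fun \<mu> (zeta c \<alpha>) S)"

end

theory Submission
  imports Defs
begin

text \<open>Slightly enlarging a closed set changes its \<^const>\<open>zeta\<close> value only a little, so the suprema defining
  the Federer density \<open>d\<close> are lower semicontinuous and \<open>d\<close> is Borel.  If \<open>d < s\<close> on \<open>E\<close>, then \<open>\<mu> E\<close> is at
  most \<open>s\<close> times the Hausdorff measure of \<open>E\<close>: every sufficiently small closed set \<open>S\<close> meeting the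
  appropriate part of \<open>E\<close> has \<open>\<mu> S \<le> s * zeta S\<close>, so coverings can be compared termwise, and regularity
  passes to the increasing union of these parts.  If \<open>d > s\<close> on \<open>E\<close>, a Vitali covering argument with
  disjoint closed sets \<open>S\<close> satisfying \<open>\<mu> S > s * zeta S\<close> inside an open \<open>V \<supseteq> E\<close> gives the opposite
  inequality with \<open>\<mu> V\<close>, and outer regularity replaces \<open>V\<close> by \<open>E\<close>.  Absolute continuity enters twice:
  it excludes singletons, which have \<open>zeta\<close> value 0, from the covering argument, and it makes \<open>{d = \<infinity>}\<close>
  a \<open>\<mu>\<close>-null set; \<open>{d = 0}\<close> is \<open>\<mu>\<close>-null by \<open>\<sigma>\<close>-finiteness.  Slicing \<open>{0 < d < \<infinity>}\<close> into the level sets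
  \<open>{t ^ k < d \<le> t ^ (k + 1)}\<close> and letting \<open>t\<close> decrease to 1 yields the formula.\<close>

section \<open>Metric outer measures and regularity\<close>

lemma measure_over_empty: "measure_over \<mu> \<Longrightarrow> \<mu> {} = 0"
  by (simp add: measure_over_def outer_measure_space_def positive_def)

lemma measure_over_mono: "measure_over \<mu> \<Longrightarrow> S \<subseteq> T \<Longrightarrow> \<mu> S \<le> \<mu> T"
  by (simp add: measure_over_def outer_measure_space_def increasing_def)

text \<open>The predicate \<open>countably_subadditive\<close> speaks of disjoint families only;
  \<open>disjointed\<close> and monotonicity extend the inequality to all sequences.\<close>

lemma measure_over_UN_le:
  fixes E :: "nat \<Rightarrow> 'a set"
  assumes "measure_over \<mu>"
  shows "\<mu> (\<Union>i. E i) \<le> (\<Sum>i. \<mu> (E i))"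
proof -
  have "\<mu> (\<Union>i. disjointed E i) \<le> (\<Sum>i. \<mu> (disjointed E i))"
    using assms disjoint_family_disjointed[of E]
    by (auto simp: measure_over_def outer_measure_space_def countably_subadditive_def)
  also have "\<dots> \<le> (\<Sum>i. \<mu> (E i))"
    by (intro suminf_le measure_over_mono[OF assms] disjointed_subset) auto
  finally show ?thesis by (simp add: UN_disjointed_eq)
qed

lemma measure_over_Un_le:
  assumes "measure_over \<mu>"
  shows "\<mu> (S \<union> T) \<le> \<mu> S + \<mu> T"
proof -
  have "\<mu> (\<Union>i. binaryset S T i) \<le> (\<Sum>i. \<mu> (binaryset S T i))"
    by (rule measure_over_UN_le[OF assms])
  also have "\<dots> = \<mu> S + \<mu> T"
    by (rule suminf_binaryset_eq) (rule measure_over_empty[OF assms])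
  finally show ?thesis by (simp add: UN_binaryset_eq)
qed

lemma measure_over_UN_zero:
  assumes "measure_over \<mu>" "countable I" "\<And>i. i \<in> I \<Longrightarrow> \<mu> (E i) = 0"
  shows "\<mu> (\<Union>i\<in>I. E i) = 0"
proof (cases "I = {}")
  case True
  then show ?thesis by (simp add: measure_over_empty[OF assms(1)])
next
  case False
  have "\<mu> (\<Union>i\<in>I. E i) = \<mu> (\<Union>n. E (from_nat_into I n))"
    using UN_from_nat_into[OF assms(2) False] by metis
  also have "\<dots> \<le> (\<Sum>n. \<mu> (E (from_nat_into I n)))"
    by (rule measure_over_UN_le[OF assms(1)])
  also have "\<dots> = 0"
    using assms(3) from_nat_into[OF False] by simp
  finally show ?thesis by simp
qed

text \<open>Subadditivity supplies the reverse inequality, so one direction of the Caratheodory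
  condition is enough.\<close>

lemma caratheodory_setsI:
  assumes "measure_over \<mu>" and "\<And>T. \<mu> (E \<inter> T) + \<mu> (- E \<inter> T) \<le> \<mu> T"
  shows "E \<in> caratheodory_sets \<mu>"
proof -
  have "\<mu> T \<le> \<mu> (E \<inter> T) + \<mu> (- E \<inter> T)" for T
    using measure_over_Un_le[OF assms(1), of "E \<inter> T" "- E \<inter> T"]
    by (simp add: Int_Un_distrib2[symmetric])
  then show ?thesis
    using assms(2) by (auto simp: caratheodory_sets_def lambda_system_def Compl_eq_Diff_UNIV[symmetric]
      intro!: antisym)
qed

lemma sigma_algebra_caratheodory_sets:
  "measure_over \<mu> \<Longrightarrow> sigma_algebra UNIV (caratheodory_sets \<mu>)"
  using measure_space_caratheodory_sets by (auto simp: measure_space_def)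

lemma tendsto_suminf_tail_ennreal:
  fixes f :: "nat \<Rightarrow> ennreal"
  assumes "(\<Sum>i. f i) < \<infinity>"
  shows "(\<lambda>n. \<Sum>i. f (i + n)) \<longlonglongrightarrow> 0"
proof -
  have fin: "f i < top" for i
    using ennreal_suminf_lessD[OF assms] by simp
  define g where "g i = enn2real (f i)" for i
  have f: "f i = ennreal (g i)" and g: "0 \<le> g i" for i
    using fin by (auto simp: g_def)
  have sum: "summable g"
    using assms g by (intro summable_suminf_not_top) (auto simp: f)
  have "(\<Sum>i. f (i + n)) = ennreal (\<Sum>i. g (i + n))" for n
    unfolding f using g sum by (intro suminf_ennreal2) (auto simp: summable_iff_shift)
  moreover have "(\<lambda>n. ennreal (\<Sum>i. g (i + n))) \<longlonglongrightarrow> ennreal 0"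
    by (intro tendsto_ennrealI suminf_exist_split2 sum)
  ultimately show ?thesis by simp
qed

text \<open>Tails of a series with finite sum tend to 0. This is how the Caratheodory criterion and
  the Vitali covering argument discard their remainders.\<close>

lemma le_add_suminf_tail_ennreal:
  fixes f :: "nat \<Rightarrow> ennreal"
  assumes "(\<Sum>i. f i) < \<infinity>" and "\<And>n. a \<le> b + (\<Sum>i. f (i + n))"
  shows "a \<le> b"
proof -
  have "(\<lambda>n. b + (\<Sum>i. f (i + n))) \<longlonglongrightarrow> b + 0"
    by (intro tendsto_add tendsto_const tendsto_suminf_tail_ennreal assms)
  then show ?thesis
    using assms(2) by (intro LIMSEQ_le_const[of _ b]) auto
qed

text \<open>Caratheodory's criterion. The part \<open>W n\<close> of \<open>T\<close> at distance at
  least \<open>1 / (n + 1)\<close> from \<open>C\<close> is separated from \<open>C\<close>, so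
  \<mu> is superadditive on the two. The rest of \<open>T - C\<close> is a union of shells
  \<open>R k\<close>. Shells of equal parity are separated from each other, so the sum of all
  \<open>\<mu> (R k)\<close> is at most \<open>2 * \<mu> T\<close> and its tails vanish when
  \<open>\<mu> T\<close> is finite.\<close>

lemma metric_outer_measure_closed:
  fixes \<mu> :: "'a::metric_space set \<Rightarrow> ennreal"
  assumes mo: "measure_over \<mu>"
    and met: "\<And>S T d. 0 < d \<Longrightarrow> (\<And>x y. x \<in> S \<Longrightarrow> y \<in> T \<Longrightarrow> d \<le> dist x y) \<Longrightarrow> \<mu> S + \<mu> T \<le> \<mu> (S \<union> T)"
    and C: "closed C"
  shows "C \<in> caratheodory_sets \<mu>"
proof (cases "C = {}")
  case True
  show ?thesis
    by (rule caratheodory_setsI[OF mo]) (simp add: True measure_over_empty[OF mo])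
next
  case ne: False
  show ?thesis
  proof (rule caratheodory_setsI[OF mo])
    fix T
    show "\<mu> (C \<inter> T) + \<mu> (- C \<inter> T) \<le> \<mu> T"
    proof (cases "\<mu> T = \<infinity>")
      case False
      then have fin: "\<mu> T < \<infinity>" by (simp add: less_top)
      define W where "W n = {x\<in>T. 1 / (real n + 1) \<le> infdist x C}" for n
      define R where "R n = {x\<in>T. 1 / (real n + 2) \<le> infdist x C \<and> infdist x C < 1 / (real n + 1)}" for n
      have odd_even: "(\<Sum>k<n. \<mu> (R (2 * k + i))) \<le> \<mu> (\<Union>k<n. R (2 * k + i))" for n i
      proof (induction n)
        case (Suc n)
        \<comment> \<open>The earlier shells stay at distance at least
          \<open>1 / (2 * n + i)\<close> from \<open>C\<close>, while the new one lies within
          \<open>1 / (2 * n + i + 1)\<close>; \<open>?d\<close> is this gap. For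
          \<open>n = 0\<close> there are no earlier shells, and \<open>?d\<close> may be negative
          since 1 / 0 is 0.\<close>
        let ?d = "1 / (real (2 * n + i)) - 1 / (real (2 * n + i) + 1)"
        show ?case
        proof (cases "n = 0")
          case True
          then show ?thesis by (simp add: lessThan_Suc measure_over_empty[OF mo])
        next
          case False
          then have "0 < real (2 * n + i)" by simp
          then have d: "0 < ?d" by (simp add: divide_strict_left_mono)
          have "?d \<le> dist x y" if "x \<in> (\<Union>k<n. R (2 * k + i))" "y \<in> R (2 * n + i)" for x y
          proof -
            from that obtain k where k: "k < n" "1 / (real (2 * k + i) + 2) \<le> infdist x C"
              by (auto simp: R_def)
            have "1 / real (2 * n + i) \<le> 1 / (real (2 * k + i) + 2)"
              using k(1) by (intro divide_left_mono) auto
            moreover have "infdist y C < 1 / (real (2 * n + i) + 1)"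
              using that by (auto simp: R_def)
            moreover have "infdist x C \<le> infdist y C + dist x y"
              by (rule infdist_triangle)
            ultimately show ?thesis using k(2) by linarith
          qed
          then have "\<mu> (\<Union>k<n. R (2 * k + i)) + \<mu> (R (2 * n + i)) \<le> \<mu> ((\<Union>k<n. R (2 * k + i)) \<union> R (2 * n + i))"
            by (intro met[OF d])
          then have "\<mu> (\<Union>k<n. R (2 * k + i)) + \<mu> (R (2 * n + i)) \<le> \<mu> (\<Union>k<Suc n. R (2 * k + i))"
            by (simp add: lessThan_Suc Un_commute)
          then show ?thesis
            using order_trans[OF add_right_mono[OF Suc.IH]] by simp
        qed
      qed (simp add: measure_over_empty[OF mo])
      have "(\<Union>k<n. R (2 * k + i)) \<subseteq> T" for n i
        by (auto simp: R_def)
      then have half: "(\<Sum>k<n. \<mu> (R (2 * k + i))) \<le> \<mu> T" for n i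
        by (rule order_trans[OF odd_even measure_over_mono[OF mo]])
      have split: "(\<Sum>k<2 * n. \<mu> (R k)) = (\<Sum>k<n. \<mu> (R (2 * k + 0))) + (\<Sum>k<n. \<mu> (R (2 * k + 1)))" for n
        by (induction n) (auto simp: ac_simps)
      have "(\<Sum>k<n. \<mu> (R k)) \<le> \<mu> T + \<mu> T" for n
      proof -
        have "(\<Sum>k<n. \<mu> (R k)) \<le> (\<Sum>k<2 * n. \<mu> (R k))"
          by (intro sum_mono2) auto
        also have "\<dots> \<le> \<mu> T + \<mu> T"
          unfolding split by (intro add_mono half)
        finally show ?thesis .
      qed
      then have "(\<Sum>k. \<mu> (R k)) \<le> \<mu> T + \<mu> T"
        by (intro suminf_le_const summableI)
      also have "\<dots> < \<infinity>" using fin by simp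
      finally have sumR: "(\<Sum>k. \<mu> (R k)) < \<infinity>" .
      have cover: "- C \<inter> T \<subseteq> W n \<union> (\<Union>k. R (k + n))" for n
      proof
        fix x assume x: "x \<in> - C \<inter> T"
        show "x \<in> W n \<union> (\<Union>k. R (k + n))"
        proof (cases "x \<in> W n")
          case False
          then have lt: "infdist x C < 1 / (real n + 1)" using x by (auto simp: W_def)
          have "infdist x C \<noteq> 0"
            using x in_closed_iff_infdist_zero[OF C ne] by auto
          then have "0 < infdist x C" by (simp add: less_le infdist_nonneg)
          then obtain m where m: "1 / real (Suc m) < infdist x C" using nat_approx_posE by blast
          \<comment> \<open>The least \<open>k\<close> with \<open>P k\<close> selects the shell of
            \<open>x\<close>: minimality gives the strict upper bound, or \<open>lt\<close> does
            when \<open>k = 0\<close>.\<close>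
          define P where "P k \<longleftrightarrow> 1 / (real (k + n) + 2) \<le> infdist x C" for k
          have "1 / (real (m + n) + 2) \<le> 1 / real (Suc m)"
            by (intro divide_left_mono) auto
          with m have "P m" by (simp add: P_def)
          then have P: "P (LEAST k. P k)" by (rule LeastI)
          have "x \<in> R ((LEAST k. P k) + n)"
          proof (cases "LEAST k. P k")
            case 0
            then show ?thesis using P lt x by (simp add: R_def P_def)
          next
            case (Suc j)
            then have "\<not> P j" using not_less_Least[of j P] by simp
            then show ?thesis using P x Suc by (simp add: R_def P_def algebra_simps)
          qed
          then show ?thesis by blast
        qed auto
      qed
      show ?thesis
      proof (rule le_add_suminf_tail_ennreal[OF sumR])
        fix n
        have "\<mu> (C \<inter> T) + \<mu> (W n) \<le> \<mu> (C \<inter> T \<union> W n)"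
        proof (rule met)
          show "0 < 1 / (real n + 1)" by simp
          show "1 / (real n + 1) \<le> dist x y" if "x \<in> C \<inter> T" "y \<in> W n" for x y
            using that infdist_le[of x C y] by (auto simp: W_def dist_commute)
        qed
        also have "\<dots> \<le> \<mu> T"
          by (rule measure_over_mono[OF mo]) (auto simp: W_def)
        finally have le: "\<mu> (C \<inter> T) + \<mu> (W n) \<le> \<mu> T" .
        have "\<mu> (- C \<inter> T) \<le> \<mu> (W n) + \<mu> (\<Union>k. R (k + n))"
          by (rule order_trans[OF measure_over_mono[OF mo cover] measure_over_Un_le[OF mo]])
        also have "\<dots> \<le> \<mu> (W n) + (\<Sum>k. \<mu> (R (k + n)))"
          by (intro add_left_mono measure_over_UN_le[OF mo])
        finally have "\<mu> (C \<inter> T) + \<mu> (- C \<inter> T) \<le> \<mu> (C \<inter> T) + (\<mu> (W n) + (\<Sum>k. \<mu> (R (k + n))))"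
          by (rule add_left_mono)
        also have "\<dots> \<le> \<mu> T + (\<Sum>k. \<mu> (R (k + n)))"
          using le by (simp add: add.assoc[symmetric] add_right_mono)
        finally show "\<mu> (C \<inter> T) + \<mu> (- C \<inter> T) \<le> \<mu> T + (\<Sum>k. \<mu> (R (k + n)))" .
      qed
    qed simp
  qed
qed

lemma metric_outer_measure_borel:
  fixes \<mu> :: "'a::metric_space set \<Rightarrow> ennreal"
  assumes mo: "measure_over \<mu>"
    and met: "\<And>S T d. 0 < d \<Longrightarrow> (\<And>x y. x \<in> S \<Longrightarrow> y \<in> T \<Longrightarrow> d \<le> dist x y) \<Longrightarrow> \<mu> S + \<mu> T \<le> \<mu> (S \<union> T)"
  shows "borel_measure \<mu>"
proof -
  interpret sigma_algebra UNIV "caratheodory_sets \<mu>"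
    by (rule sigma_algebra_caratheodory_sets[OF mo])
  show ?thesis
    unfolding borel_measure_def borel_eq_closed
    by (auto intro!: sigma_sets_subset metric_outer_measure_closed[OF mo met] simp: sets_measure_of_conv)
qed

section \<open>Approximation of Borel sets by closed and open sets\<close>

text \<open>Induction along the generation of the Borel sets by closed sets. Carrying a closed set
  inside together with an open set outside makes the property stable under complements. Intersecting
  with \<open>U\<close> provides the finiteness that continuity from above asks for.\<close>

lemma open_approximation_borel:
  fixes M :: "'a::metric_space measure"
  assumes sets: "sets M = sets borel" and U: "open U" "emeasure M U < \<infinity>" and E: "E \<in> sets borel"
    and e: "0 < (e::real)"
  shows "\<exists>F V. closed F \<and> open V \<and> F \<subseteq> E \<and> E \<subseteq> V \<and> emeasure M ((V - F) \<inter> U) < ennreal e"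
proof -
  have bor: "open S \<Longrightarrow> S \<in> sets M" "closed S \<Longrightarrow> S \<in> sets M" for S by (simp_all add: sets)
  have "E \<in> sigma_sets UNIV {S. closed S}"
    using E unfolding borel_eq_closed by (simp add: sets_measure_of_conv)
  then show ?thesis using e
  proof (induction arbitrary: e)
    case (Basic C)
    then have C: "closed C" by simp
    show ?case
    \<comment> \<open>\<open>infdist\<close> to the empty set is 0 by convention, so the
      neighbourhoods \<open>V n\<close> below would then be the whole space.\<close>
    proof (cases "C = {}")
      case True
      then show ?thesis using Basic by (intro exI[of _ "{}"]) auto
    next
      case False
      define V where "V n = {x. infdist x C < 1 / (real n + 1)}" for n
      have V: "open (V n)" for n
        unfolding V_def by (intro open_Collect_less continuous_intros)
      have CV: "C \<subseteq> V n" for n by (auto simp: V_def)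
      have "(\<lambda>n. emeasure M ((V n - C) \<inter> U)) \<longlonglongrightarrow> emeasure M (\<Inter>n. (V n - C) \<inter> U)"
      proof (rule Lim_emeasure_decseq)
        show "range (\<lambda>n. (V n - C) \<inter> U) \<subseteq> sets M"
          using V C U bor by (auto intro!: sets.Int sets.Diff)
        have "V n \<subseteq> V m" if "m \<le> n" for m n
        proof -
          have "1 / (real n + 1) \<le> 1 / (real m + 1)"
            using that by (intro divide_left_mono) auto
          then show ?thesis unfolding V_def by auto
        qed
        then show "decseq (\<lambda>n. (V n - C) \<inter> U)"
          unfolding decseq_def by blast
        show "emeasure M ((V n - C) \<inter> U) \<noteq> \<infinity>" for n
          using U emeasure_mono[of "(V n - C) \<inter> U" U M] bor by (auto simp: top_unique)
      qed
      moreover have "(\<Inter>n. (V n - C) \<inter> U) = {}"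
      proof -
        have "x \<in> C" if "\<And>n. x \<in> V n" for x
        proof (rule ccontr)
          assume "x \<notin> C"
          then have "0 < infdist x C"
            using in_closed_iff_infdist_zero[OF C False] infdist_nonneg[of x C] by (auto simp: less_le)
          then obtain m where m: "1 / real (Suc m) < infdist x C" using nat_approx_posE by blast
          then show False using that[of m] by (auto simp: V_def add.commute)
        qed
        then show ?thesis by blast
      qed
      ultimately have "(\<lambda>n. emeasure M ((V n - C) \<inter> U)) \<longlonglongrightarrow> 0" by simp
      then have "eventually (\<lambda>n. emeasure M ((V n - C) \<inter> U) < ennreal e) sequentially"
        using Basic by (intro order_tendstoD(2)) auto
      then obtain n where "emeasure M ((V n - C) \<inter> U) < ennreal e"
        by (auto simp: eventually_sequentially)
      then show ?thesis using V CV C by blast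
    qed
  next
    case Empty
    then show ?case by (intro exI[of _ "{}"]) auto
  next
    case (Compl a)
    from Compl.IH[OF Compl.prems]
    obtain F V where FV: "closed F" "open V" "F \<subseteq> a" "a \<subseteq> V" "emeasure M ((V - F) \<inter> U) < ennreal e"
      by (elim exE conjE)
    have "- F - - V = V - F" by auto
    then show ?case using FV by (intro exI[of _ "- V"] exI[of _ "- F"]) (auto simp: Compl_eq_Diff_UNIV[symmetric])
  next
    case (Union a)
    \<comment> \<open>The errors \<open>h i\<close> add up to \<open>e / 2\<close>; the other half
      pays for cutting the union of the \<open>F i\<close> down to a finite one.\<close>
    define h where "h i = e / 2 * (1 / 2) ^ Suc i" for i :: nat
    have h: "0 < h i" for i using Union.prems by (simp add: h_def)
    then have "\<forall>i. \<exists>F V. closed F \<and> open V \<and> F \<subseteq> a i \<and> a i \<subseteq> V \<and> emeasure M ((V - F) \<inter> U) < ennreal (h i)"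
      using Union.IH by blast
    then obtain F V where FV: "\<And>i. closed (F i)" "\<And>i. open (V i)" "\<And>i. F i \<subseteq> a i" "\<And>i. a i \<subseteq> V i"
      "\<And>i. emeasure M ((V i - F i) \<inter> U) < ennreal (h i)"
      by metis
    \<comment> \<open>Only finite unions of the \<open>F i\<close> are sure to be closed. The sets
      \<open>D n\<close> decrease to a set inside the union of the
      \<open>(V i - F i) \<inter> U\<close>, so some \<open>D n\<close> has measure below
      \<open>e\<close>.\<close>
    define G where "G n = (\<Union>i<n. F i)" for n
    have G: "closed (G n)" for n unfolding G_def using FV by (intro closed_UN) auto
    define D where "D n = ((\<Union>i. V i) - G n) \<inter> U" for n
    have Vop: "open (\<Union>i. V i)" using FV by auto
    have VF: "(V i - F i) \<inter> U \<in> sets M" for i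
      using FV(1,2) U by (intro sets.Int sets.Diff bor)
    have Dm: "D n \<in> sets M" for n
      unfolding D_def using G Vop U by (intro sets.Int sets.Diff bor)
    have lim: "(\<lambda>n. emeasure M (D n)) \<longlonglongrightarrow> emeasure M (\<Inter>n. D n)"
    proof (rule Lim_emeasure_decseq)
      show "range D \<subseteq> sets M" using Dm by auto
      have "G m \<subseteq> G n" if "m \<le> n" for m n using that by (force simp: G_def)
      then show "decseq D" unfolding decseq_def D_def by blast
      show "emeasure M (D n) \<noteq> \<infinity>" for n
        using U emeasure_mono[of "D n" U M] bor by (auto simp: top_unique D_def)
    qed
    have hs: "(\<lambda>i. h i) sums (e / 2 * 1)"
      unfolding h_def by (intro sums_mult power_half_series)
    have "emeasure M (\<Inter>n. D n) \<le> emeasure M (\<Union>i. (V i - F i) \<inter> U)"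
    proof (rule emeasure_mono)
      show "(\<Inter>n. D n) \<subseteq> (\<Union>i. (V i - F i) \<inter> U)"
      proof
        fix x assume x: "x \<in> (\<Inter>n. D n)"
        then obtain i where "x \<in> V i" "x \<in> U" by (auto simp: D_def)
        moreover have "x \<notin> F i" using x by (auto simp: D_def G_def)
        ultimately show "x \<in> (\<Union>i. (V i - F i) \<inter> U)" by blast
      qed
      show "(\<Union>i. (V i - F i) \<inter> U) \<in> sets M"
        using VF by (intro sets.countable_UN) auto
    qed
    also have "\<dots> \<le> (\<Sum>i. emeasure M ((V i - F i) \<inter> U))"
      using VF by (intro emeasure_subadditive_countably) auto
    also have "\<dots> \<le> (\<Sum>i. ennreal (h i))"
      using FV(5) by (intro suminf_le) (auto intro: less_imp_le)
    also have "\<dots> = ennreal (e / 2)"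
      using hs h by (subst suminf_ennreal2) (auto simp: sums_iff less_imp_le)
    also have "\<dots> < ennreal e" using Union.prems by (intro ennreal_lessI) auto
    finally have "eventually (\<lambda>n. emeasure M (D n) < ennreal e) sequentially"
      using order_tendstoD(2)[OF lim] by blast
    then obtain n where n: "emeasure M (D n) < ennreal e"
      by (auto simp: eventually_sequentially)
    have "G n \<subseteq> (\<Union>i. a i)" using FV(3) unfolding G_def by blast
    moreover have "(\<Union>i. a i) \<subseteq> (\<Union>i. V i)" using FV(4) by blast
    ultimately show ?case using n G[of n] Vop unfolding D_def by (intro exI conjI)
  qed
qed

text \<open>Within \<open>U\<close> some open neighbourhood of \<open>E\<close> exceeds
  \<open>E\<close> by less than \<open>e\<close>. Asking for the bound only when
  \<open>V \<subseteq> U\<close> lets it be proved for open sets of finite measure.\<close>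

lemma outer_regular_borel:
  fixes M :: "'a::metric_space measure"
  assumes sets: "sets M = sets borel" and U: "open U" "emeasure M U < \<infinity>" and E: "E \<in> sets borel" "E \<subseteq> U"
    and le: "\<And>V. open V \<Longrightarrow> E \<subseteq> V \<Longrightarrow> V \<subseteq> U \<Longrightarrow> a \<le> emeasure M V"
  shows "a \<le> emeasure M E"
proof (rule ennreal_le_epsilon)
  fix e :: real assume "0 < e"
  from open_approximation_borel[OF sets U E(1) this]
  obtain F V where FV: "closed F" "open V" "F \<subseteq> E" "E \<subseteq> V" "emeasure M ((V - F) \<inter> U) < ennreal e"
    by blast
  have "a \<le> emeasure M (V \<inter> U)"
    using FV U E by (intro le) auto
  also have "\<dots> \<le> emeasure M (E \<union> (V - F) \<inter> U)"
    using FV U E by (intro emeasure_mono) (auto simp: sets)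
  also have "\<dots> \<le> emeasure M E + emeasure M ((V - F) \<inter> U)"
    using FV U E by (intro emeasure_subadditive) (auto simp: sets)
  also have "\<dots> \<le> emeasure M E + ennreal e"
    using FV(5) by (intro add_left_mono less_imp_le)
  finally show "a \<le> emeasure M E + ennreal e" .
qed

section \<open>Hausdorff measure\<close>

lemma dist_le_ediam: "x \<in> S \<Longrightarrow> y \<in> S \<Longrightarrow> ennreal (dist x y) \<le> ediam S"
  unfolding ediam_def by (rule SUP_upper2[of "(x, y)"]) auto

lemma ediam_le: "(\<And>x y. x \<in> S \<Longrightarrow> y \<in> S \<Longrightarrow> ennreal (dist x y) \<le> D) \<Longrightarrow> ediam S \<le> D"
  unfolding ediam_def by (rule SUP_least) auto

lemma ediam_mono: "S \<subseteq> T \<Longrightarrow> ediam S \<le> ediam T"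
  by (intro ediam_le dist_le_ediam) auto

lemma ediam_empty [simp]: "ediam {} = 0"
  by (simp add: ediam_def bot_ennreal)

lemma ediam_singleton [simp]: "ediam {x} = 0"
  by (simp add: ediam_def bot_ennreal)

lemma ediam_le_real: "0 \<le> D \<Longrightarrow> ediam S \<le> ennreal D \<Longrightarrow> x \<in> S \<Longrightarrow> y \<in> S \<Longrightarrow> dist x y \<le> D"
  using dist_le_ediam[of x S y] order_trans ennreal_le_iff by metis

lemma ediam_zeroD:
  assumes "ediam S = 0" "x \<in> S"
  shows "S = {x}"
  using ediam_le_real[of 0 S x] assms by fastforce

text \<open>\<open>S\<close> lies in the closed ball of radius \<open>D\<close> about each of its
  points, hence so does its closure; by symmetry this extends to balls about points of the closure.
  Enlargements can therefore be made closed at no cost.\<close>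

lemma ediam_closure: "ediam (closure S) = ediam S"
proof (rule antisym)
  show "ediam (closure S) \<le> ediam S"
  proof (cases "ediam S = \<infinity>")
    case False
    then obtain D where D: "ediam S = ennreal D" "0 \<le> D"
      by (cases "ediam S") auto
    have "closure S \<subseteq> cball x D" if "x \<in> S" for x
      using that D ediam_le_real[of D S x] by (intro closure_minimal) auto
    then have cl: "closure S \<subseteq> cball y D" if "y \<in> closure S" for y
    proof (intro closure_minimal subsetI)
      fix x assume "x \<in> S"
      then show "x \<in> cball y D"
        using \<open>x \<in> S \<Longrightarrow> closure S \<subseteq> cball x D\<close> that by (auto simp: dist_commute)
    qed simp
    have "dist x y \<le> D" if "x \<in> closure S" "y \<in> closure S" for x y
      using cl[OF that(1)] that(2) by auto
    then show ?thesis
      by (intro ediam_le) (auto simp: D ennreal_leI)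
  qed simp
qed (intro ediam_mono closure_subset)

lemma zeta_less_top_iff: "zeta c \<alpha> S < \<infinity> \<longleftrightarrow> ediam S < \<infinity>"
  by (auto simp: zeta_def less_top)

lemma zeta_empty [simp]: "zeta c \<alpha> {} = 0"
  by (simp add: zeta_def)

lemma zeta_le:
  assumes "0 < c" "0 < \<alpha>" "0 \<le> D" "ediam S \<le> ennreal D"
  shows "zeta c \<alpha> S \<le> ennreal (c * D powr \<alpha>)"
proof -
  have "ediam S \<noteq> \<infinity>" using assms(4) by (auto simp: top_unique)
  moreover have "enn2real (ediam S) \<le> D" using assms by (simp add: enn2real_leI)
  ultimately show ?thesis
    using assms by (auto simp: zeta_def intro!: ennreal_leI mult_left_mono powr_mono2)
qed

lemma zeta_scale_le:
  assumes "0 < c" "0 < \<alpha>" "0 < k" "ediam S \<le> ennreal k * ediam T"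
  shows "zeta c \<alpha> S \<le> ennreal (k powr \<alpha>) * zeta c \<alpha> T"
proof (cases "ediam T")
  case (real r)
  have "zeta c \<alpha> S \<le> ennreal (c * (k * r) powr \<alpha>)"
    using assms real by (intro zeta_le) (auto simp: ennreal_mult)
  also have "\<dots> = ennreal (k powr \<alpha>) * zeta c \<alpha> T"
    using assms real by (simp add: zeta_def powr_mult ennreal_mult[symmetric] ac_simps)
  finally show ?thesis .
next
  case top
  then show ?thesis using assms by (simp add: zeta_def ennreal_mult_top)
qed

definition hausdorff_premeasure :: "real \<Rightarrow> real \<Rightarrow> real \<Rightarrow> 'a::metric_space set \<Rightarrow> ennreal" where
  "hausdorff_premeasure c \<alpha> \<delta> R =
    (INF E\<in>{E :: nat \<Rightarrow> 'a set.
        (\<forall>j. closed (E j) \<and> ediam (E j) \<le> ennreal \<delta>) \<and> R \<subseteq> (\<Union>j. E j)}.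
      \<Sum>j. zeta c \<alpha> (E j))"

lemma hausdorff_measure_eq: "hausdorff_measure c \<alpha> R = (SUP \<delta>\<in>{0<..}. hausdorff_premeasure c \<alpha> \<delta> R)"
  by (simp add: hausdorff_measure_def hausdorff_premeasure_def)

lemma hausdorff_premeasure_le:
  assumes "\<And>j. closed (E j)" "\<And>j. ediam (E j) \<le> ennreal \<delta>" "R \<subseteq> (\<Union>j. E j)"
  shows "hausdorff_premeasure c \<alpha> \<delta> R \<le> (\<Sum>j. zeta c \<alpha> (E j))"
  unfolding hausdorff_premeasure_def using assms by (intro INF_lower) auto

lemma le_hausdorff_premeasure:
  assumes "\<And>E. (\<And>j::nat. closed (E j)) \<Longrightarrow> (\<And>j. ediam (E j) \<le> ennreal \<delta>) \<Longrightarrow> R \<subseteq> (\<Union>j. E j)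
    \<Longrightarrow> a \<le> (\<Sum>j. zeta c \<alpha> (E j))"
  shows "a \<le> hausdorff_premeasure c \<alpha> \<delta> R"
  unfolding hausdorff_premeasure_def using assms by (intro INF_greatest) auto

lemma hausdorff_premeasure_le_measure: "0 < \<delta> \<Longrightarrow> hausdorff_premeasure c \<alpha> \<delta> R \<le> hausdorff_measure c \<alpha> R"
  unfolding hausdorff_measure_eq by (intro SUP_upper) auto

lemma hausdorff_measure_le:
  "(\<And>\<delta>. 0 < \<delta> \<Longrightarrow> hausdorff_premeasure c \<alpha> \<delta> R \<le> a) \<Longrightarrow> hausdorff_measure c \<alpha> R \<le> a"
  unfolding hausdorff_measure_eq by (intro SUP_least) auto

lemma hausdorff_premeasure_mono: "S \<subseteq> T \<Longrightarrow> hausdorff_premeasure c \<alpha> \<delta> S \<le> hausdorff_premeasure c \<alpha> \<delta> T"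
  by (rule le_hausdorff_premeasure, rule hausdorff_premeasure_le) auto

lemma hausdorff_premeasure_antimono:
  "\<delta> \<le> \<delta>' \<Longrightarrow> hausdorff_premeasure c \<alpha> \<delta>' S \<le> hausdorff_premeasure c \<alpha> \<delta> S"
  by (rule le_hausdorff_premeasure, rule hausdorff_premeasure_le) (auto intro: order_trans[OF _ ennreal_leI])

lemma hausdorff_premeasure_singleton: "hausdorff_premeasure c \<alpha> \<delta> {x} = 0"
proof -
  have "hausdorff_premeasure c \<alpha> \<delta> {x} \<le> (\<Sum>j::nat. zeta c \<alpha> {x})"
    by (rule hausdorff_premeasure_le) auto
  then show ?thesis by (simp add: zeta_def)
qed

text \<open>With absolute continuity this shows that \<mu> has no atoms in \<open>A\<close>.\<close>

lemma hausdorff_measure_singleton: "hausdorff_measure c \<alpha> {x} = 0"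
  by (simp add: hausdorff_measure_eq hausdorff_premeasure_singleton)

text \<open>Coverings of the \<open>R i\<close> that are optimal up to \<open>h i\<close> are merged
  into one sequence through \<open>prod_decode\<close>; the errors add up to
  \<open>e\<close>.\<close>

lemma hausdorff_premeasure_UN_le:
  fixes R :: "nat \<Rightarrow> 'a::metric_space set"
  shows "hausdorff_premeasure c \<alpha> \<delta> (\<Union>i. R i) \<le> (\<Sum>i. hausdorff_premeasure c \<alpha> \<delta> (R i))"
proof (rule ennreal_le_epsilon)
  fix e :: real
  assume fin: "(\<Sum>i. hausdorff_premeasure c \<alpha> \<delta> (R i)) < top" and e: "0 < e"
  define h where "h i = e * (1 / 2) ^ Suc i" for i :: nat
  have "\<exists>E. (\<forall>j::nat. closed (E j) \<and> ediam (E j) \<le> ennreal \<delta>) \<and> R i \<subseteq> (\<Union>j. E j) \<and>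
      (\<Sum>j. zeta c \<alpha> (E j)) \<le> hausdorff_premeasure c \<alpha> \<delta> (R i) + ennreal (h i)" for i
  proof -
    \<comment> \<open>Finiteness makes the addition of \<open>h i\<close> a strict increase, so some
      covering undercuts the new bound.\<close>
    have "hausdorff_premeasure c \<alpha> \<delta> (R i) < top"
      using ennreal_suminf_lessD[OF fin] .
    then have "hausdorff_premeasure c \<alpha> \<delta> (R i) < hausdorff_premeasure c \<alpha> \<delta> (R i) + ennreal (h i)"
      using e by (auto simp: h_def ennreal_zero_less_mult_iff)
    then obtain E where "(\<forall>j::nat. closed (E j) \<and> ediam (E j) \<le> ennreal \<delta>) \<and> R i \<subseteq> (\<Union>j. E j)"
      "(\<Sum>j. zeta c \<alpha> (E j)) < hausdorff_premeasure c \<alpha> \<delta> (R i) + ennreal (h i)"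
      unfolding hausdorff_premeasure_def[of c \<alpha> \<delta> "R i"] INF_less_iff by blast
    then show ?thesis by (intro exI[of _ E]) (simp add: less_imp_le)
  qed
  then obtain E where E: "\<And>i j::nat. closed (E i j)" "\<And>i j. ediam (E i j) \<le> ennreal \<delta>"
      "\<And>i. R i \<subseteq> (\<Union>j. E i j)"
      "\<And>i. (\<Sum>j. zeta c \<alpha> (E i j)) \<le> hausdorff_premeasure c \<alpha> \<delta> (R i) + ennreal (h i)"
    by metis
  have "hausdorff_premeasure c \<alpha> \<delta> (\<Union>i. R i) \<le> (\<Sum>k. zeta c \<alpha> (case prod_decode k of (i, j) \<Rightarrow> E i j))"
  proof (rule hausdorff_premeasure_le)
    show "(\<Union>i. R i) \<subseteq> (\<Union>k. case prod_decode k of (i, j) \<Rightarrow> E i j)"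
    proof
      fix x assume "x \<in> (\<Union>i. R i)"
      then obtain i j where "x \<in> E i j" using E(3) by blast
      then show "x \<in> (\<Union>k. case prod_decode k of (i, j) \<Rightarrow> E i j)"
        by (intro UN_I[of "prod_encode (i, j)"]) auto
    qed
  qed (auto simp: E split: prod.split)
  also have "\<dots> = (\<Sum>i. \<Sum>j. zeta c \<alpha> (E i j))"
    using suminf_ennreal_2dimen[of "\<lambda>i. \<Sum>j. zeta c \<alpha> (E i j)" "\<lambda>p. zeta c \<alpha> (case p of (i, j) \<Rightarrow> E i j)"]
    by simp
  also have "\<dots> \<le> (\<Sum>i. hausdorff_premeasure c \<alpha> \<delta> (R i) + ennreal (h i))"
    by (intro suminf_le E) auto
  also have "\<dots> = (\<Sum>i. hausdorff_premeasure c \<alpha> \<delta> (R i)) + (\<Sum>i. ennreal (h i))"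
    by (intro suminf_add[symmetric]) auto
  also have "(\<Sum>i. ennreal (h i)) = ennreal e"
  proof -
    have "h sums (e * 1)"
      unfolding h_def by (intro sums_mult power_half_series)
    then show ?thesis
      using e by (subst suminf_ennreal2) (auto simp: sums_iff h_def)
  qed
  finally show "hausdorff_premeasure c \<alpha> \<delta> (\<Union>i. R i) \<le> (\<Sum>i. hausdorff_premeasure c \<alpha> \<delta> (R i)) + ennreal e" .
qed

lemma measure_over_hausdorff: "measure_over (hausdorff_measure c \<alpha> :: 'a::metric_space set \<Rightarrow> ennreal)"
  unfolding measure_over_def outer_measure_space_def
proof (intro conjI)
  have "hausdorff_measure c \<alpha> ({} :: 'a set) \<le> hausdorff_measure c \<alpha> {x}" for x :: 'a
    unfolding hausdorff_measure_eq by (intro SUP_mono' hausdorff_premeasure_mono) auto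
  then show "positive UNIV (hausdorff_measure c \<alpha> :: 'a set \<Rightarrow> ennreal)"
    by (simp add: positive_def hausdorff_measure_singleton)
  show "increasing UNIV (hausdorff_measure c \<alpha> :: 'a set \<Rightarrow> ennreal)"
    unfolding increasing_def hausdorff_measure_eq
    by (auto intro!: SUP_mono' hausdorff_premeasure_mono)
  show "countably_subadditive UNIV (hausdorff_measure c \<alpha> :: 'a set \<Rightarrow> ennreal)"
    unfolding countably_subadditive_def
  proof (intro allI impI hausdorff_measure_le)
    fix R :: "nat \<Rightarrow> 'a set" and \<delta> :: real
    assume "0 < \<delta>"
    then have le: "(\<Sum>i. hausdorff_premeasure c \<alpha> \<delta> (R i)) \<le> (\<Sum>i. hausdorff_measure c \<alpha> (R i))"
      by (intro suminf_le hausdorff_premeasure_le_measure) auto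
    show "hausdorff_premeasure c \<alpha> \<delta> (\<Union>i. R i) \<le> (\<Sum>i. hausdorff_measure c \<alpha> (R i))"
      by (rule order_trans[OF hausdorff_premeasure_UN_le le])
  qed
qed

text \<open>At a scale below \<open>d\<close> no covering set meets both \<open>S\<close> and
  \<open>T\<close>, so each covering of the union splits into two and Caratheodory's criterion
  applies.\<close>

lemma borel_measure_hausdorff: "borel_measure (hausdorff_measure c \<alpha> :: 'a::metric_space set \<Rightarrow> ennreal)"
proof (rule metric_outer_measure_borel[OF measure_over_hausdorff])
  fix S T :: "'a set" and d :: real
  assume d: "0 < d" and far: "\<And>x y. x \<in> S \<Longrightarrow> y \<in> T \<Longrightarrow> d \<le> dist x y"
  let ?H = "hausdorff_premeasure c \<alpha>"
  have small: "?H \<delta> S + ?H \<delta> T \<le> ?H \<delta> (S \<union> T)" if \<delta>: "0 < \<delta>" "\<delta> < d" for \<delta>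
  proof (rule le_hausdorff_premeasure)
    fix E :: "nat \<Rightarrow> 'a set"
    assume E: "\<And>j. closed (E j)" "\<And>j. ediam (E j) \<le> ennreal \<delta>" "S \<union> T \<subseteq> (\<Union>j. E j)"
    \<comment> \<open>Sets that miss \<open>Q\<close> are replaced by the empty set, which has
      \<open>zeta\<close> value 0.\<close>
    let ?P = "\<lambda>Q j. if E j \<inter> Q = {} then {} else E j"
    have P: "?H \<delta> Q \<le> (\<Sum>j. zeta c \<alpha> (?P Q j))" if sub: "Q \<subseteq> S \<union> T" for Q
    proof (rule hausdorff_premeasure_le)
      show "Q \<subseteq> (\<Union>j. ?P Q j)"
      proof
        fix x assume x: "x \<in> Q"
        then obtain j where "x \<in> E j" using sub E(3) by blast
        then show "x \<in> (\<Union>j. ?P Q j)" using x by (intro UN_I[of j]) auto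
      qed
    qed (use E in auto)
    have "?H \<delta> S + ?H \<delta> T \<le> (\<Sum>j. zeta c \<alpha> (?P S j)) + (\<Sum>j. zeta c \<alpha> (?P T j))"
      by (intro add_mono P) auto
    also have "\<dots> = (\<Sum>j. zeta c \<alpha> (?P S j) + zeta c \<alpha> (?P T j))"
      by (intro suminf_add) auto
    also have "\<dots> \<le> (\<Sum>j. zeta c \<alpha> (E j))"
    proof (intro suminf_le)
      fix j
      have "E j \<inter> S = {} \<or> E j \<inter> T = {}"
        using far ediam_le_real[OF less_imp_le[OF \<delta>(1)] E(2)] \<delta>(2) by fastforce
      then show "zeta c \<alpha> (?P S j) + zeta c \<alpha> (?P T j) \<le> zeta c \<alpha> (E j)" by auto
    qed auto
    finally show "?H \<delta> S + ?H \<delta> T \<le> (\<Sum>j. zeta c \<alpha> (E j))" .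
  qed
  \<comment> \<open>The two suprema over scales are independent, so two scales are allowed and
    compared with a common finer one below \<open>d\<close>.\<close>
  have le: "?H \<delta> S + ?H \<delta>' T \<le> hausdorff_measure c \<alpha> (S \<union> T)" if "0 < \<delta>" "0 < \<delta>'" for \<delta> \<delta>'
  proof -
    define \<epsilon> where "\<epsilon> = min (min \<delta> \<delta>') (d / 2)"
    have \<epsilon>: "0 < \<epsilon>" "\<epsilon> < d" "\<epsilon> \<le> \<delta>" "\<epsilon> \<le> \<delta>'" using that d by (auto simp: \<epsilon>_def)
    have "?H \<delta> S + ?H \<delta>' T \<le> ?H \<epsilon> S + ?H \<epsilon> T"
      by (intro add_mono hausdorff_premeasure_antimono \<epsilon>)
    also have "\<dots> \<le> ?H \<epsilon> (S \<union> T)" by (rule small[OF \<epsilon>(1,2)])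
    also have "\<dots> \<le> hausdorff_measure c \<alpha> (S \<union> T)" by (rule hausdorff_premeasure_le_measure[OF \<epsilon>(1)])
    finally show ?thesis .
  qed
  have ne: "{0::real<..} \<noteq> {}" using greaterThan_iff[of 1 "0::real"] by force
  show "hausdorff_measure c \<alpha> S + hausdorff_measure c \<alpha> T \<le> hausdorff_measure c \<alpha> (S \<union> T)"
    unfolding hausdorff_measure_eq[of c \<alpha> S] hausdorff_measure_eq[of c \<alpha> T]
    ennreal_SUP_add_left[OF ne, symmetric] ennreal_SUP_add_right[OF ne]
    by (intro SUP_least le) auto
qed

section \<open>Measurability of the Federer density\<close>

definition federer_sup :: "real \<Rightarrow> real \<Rightarrow> ('a::metric_space set \<Rightarrow> ennreal) \<Rightarrow> real \<Rightarrow> 'a \<Rightarrow> ennreal" where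
  "federer_sup c \<alpha> \<mu> \<epsilon> x =
    (SUP S\<in>{S \<in> closed_family \<mu> (zeta c \<alpha>). x \<in> S \<and> ediam S < ennreal \<epsilon>}. quotient_fun \<mu> (zeta c \<alpha>) S)"

lemma federer_density_eq: "federer_density c \<alpha> \<mu> x = (INF \<epsilon>\<in>{0<..}. federer_sup c \<alpha> \<mu> \<epsilon> x)"
  by (simp add: federer_density_def federer_sup_def)

text \<open>Multiplying out merges the cases of \<open>quotient_fun\<close>: if \<open>zeta\<close>
  is 0, membership in \<open>closed_family\<close> means that \<open>\<mu> S\<close> is positive.
  Finite diameter excludes an infinite \<open>zeta\<close> value.\<close>

lemma less_quotient_fun_iff:
  assumes "0 < c" "closed S" "ediam S < \<infinity>"
  shows "S \<in> closed_family \<mu> (zeta c \<alpha>) \<and> t < quotient_fun \<mu> (zeta c \<alpha>) S \<longleftrightarrow> t < \<infinity> \<and> t * zeta c \<alpha> S < \<mu> S"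
proof -
  have fin: "zeta c \<alpha> S < \<infinity>" using assms(3) unfolding zeta_less_top_iff .
  show ?thesis
  proof (cases "zeta c \<alpha> S = 0")
    case True
    then show ?thesis
      using assms by (auto simp: closed_family_def quotient_fun_def zero_less_iff_neq_zero)
  next
    case False
    obtain r where r: "zeta c \<alpha> S = ennreal r" "0 < r"
      using fin False by (cases "zeta c \<alpha> S") (auto simp: less_le)
    have "t < \<mu> S / ennreal r \<longleftrightarrow> t < \<infinity> \<and> t * ennreal r < \<mu> S"
    proof (cases t)
      case (real q)
      show ?thesis
      proof (cases "\<mu> S")
        case (real m)
        then show ?thesis
          using r \<open>t = ennreal q\<close> \<open>0 \<le> q\<close>
          by (simp add: divide_ennreal ennreal_mult[symmetric] ennreal_less_iff pos_less_divide_eq)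
      next
        case top
        then show ?thesis
          using r \<open>t = ennreal q\<close> by (simp add: ennreal_top_divide ennreal_mult_less_top)
      qed
    qed auto
    then show ?thesis
      using assms fin False r by (auto simp: closed_family_def quotient_fun_def)
  qed
qed

text \<open>The later comparisons of \<mu> with \<open>zeta\<close> go through this quotient-free
  form.\<close>

lemma less_federer_sup_iff:
  assumes "0 < c"
  shows "t < federer_sup c \<alpha> \<mu> \<epsilon> x \<longleftrightarrow>
    t < \<infinity> \<and> (\<exists>S. closed S \<and> x \<in> S \<and> ediam S < ennreal \<epsilon> \<and> t * zeta c \<alpha> S < \<mu> S)"
proof -
  have "t < federer_sup c \<alpha> \<mu> \<epsilon> x \<longleftrightarrow> (\<exists>S. closed S \<and> x \<in> S \<and> ediam S < ennreal \<epsilon> \<and>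
      (S \<in> closed_family \<mu> (zeta c \<alpha>) \<and> t < quotient_fun \<mu> (zeta c \<alpha>) S))"
    unfolding federer_sup_def less_SUP_iff by (auto simp: closed_family_def)
  also have "\<dots> \<longleftrightarrow> (\<exists>S. closed S \<and> x \<in> S \<and> ediam S < ennreal \<epsilon> \<and> t < \<infinity> \<and> t * zeta c \<alpha> S < \<mu> S)"
  proof (rule iff_exI)
    fix S :: "'a set"
    have "ediam S < ennreal \<epsilon> \<Longrightarrow> ediam S < \<infinity>"
      by (auto intro: less_trans)
    then show "(closed S \<and> x \<in> S \<and> ediam S < ennreal \<epsilon> \<and>
        S \<in> closed_family \<mu> (zeta c \<alpha>) \<and> t < quotient_fun \<mu> (zeta c \<alpha>) S) =
      (closed S \<and> x \<in> S \<and> ediam S < ennreal \<epsilon> \<and> t < \<infinity> \<and> t * zeta c \<alpha> S < \<mu> S)"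
      using less_quotient_fun_iff[OF assms] by blast
  qed
  finally show ?thesis by blast
qed

lemma federer_sup_mono: "\<epsilon> \<le> \<epsilon>' \<Longrightarrow> federer_sup c \<alpha> \<mu> \<epsilon> x \<le> federer_sup c \<alpha> \<mu> \<epsilon>' x"
  unfolding federer_sup_def by (rule SUP_subset_mono) (auto intro: less_le_trans ennreal_leI)

lemma ediam_UN_ball_le:
  assumes "0 \<le> D" "ediam S \<le> ennreal D" "0 < \<delta>"
  shows "ediam (\<Union>s\<in>S. ball s \<delta>) \<le> ennreal (D + 2 * \<delta>)"
proof (intro ediam_le ennreal_leI)
  fix x y assume "x \<in> (\<Union>s\<in>S. ball s \<delta>)" "y \<in> (\<Union>s\<in>S. ball s \<delta>)"
  then obtain s t where st: "s \<in> S" "t \<in> S" "dist s x < \<delta>" "dist t y < \<delta>" by auto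
  then have "dist s t \<le> D" using assms by (intro ediam_le_real)
  then show "dist x y \<le> D + 2 * \<delta>"
    using st dist_triangle[of x y s] dist_triangle[of s y t] by (simp add: dist_commute)
qed

text \<open>A closed set that beats the threshold \<open>t\<close> still does so after a slight enlargement,
  because \<^const>\<open>zeta\<close> is continuous under enlargement and \<open>\<mu>\<close> only grows.\<close>

lemma open_federer_sup_greater:
  assumes "measure_over \<mu>" "0 < c" "0 < \<alpha>"
  shows "open {x. t < federer_sup c \<alpha> \<mu> \<epsilon> x}"
proof (rule Topological_Spaces.openI)
  fix x assume "x \<in> {x. t < federer_sup c \<alpha> \<mu> \<epsilon> x}"
  then obtain S where t: "t < \<infinity>" and S: "closed S" "x \<in> S" "ediam S < ennreal \<epsilon>" "t * zeta c \<alpha> S < \<mu> S"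
    using assms(2) by (auto simp: less_federer_sup_iff)
  obtain r where r: "t = ennreal r" "0 \<le> r" using t by (cases t) auto
  obtain D where D: "ediam S = ennreal D" "0 \<le> D" using S(3) by (cases "ediam S") auto
  then have De: "D < \<epsilon>" using S(3) by (simp add: ennreal_less_iff)
  \<comment> \<open>Both strict inequalities, for the threshold and for the diameter, survive a
    small enlargement; a radius is picked far out in this null sequence.\<close>
  let ?\<delta> = "\<lambda>n::nat. inverse (real (Suc n))"
  have \<delta>: "?\<delta> \<longlonglongrightarrow> 0" by (rule LIMSEQ_inverse_real_of_nat)
  have lim1: "(\<lambda>n. D + 2 * ?\<delta> n) \<longlonglongrightarrow> D + 2 * 0"
    by (intro tendsto_intros \<delta>)
  \<comment> \<open>If \<open>S\<close> is a point, then \<open>D = 0\<close>, and continuity of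
    \<open>powr\<close> at base 0 comes from \<open>0 < \<alpha>\<close>.\<close>
  have "(\<lambda>n. ennreal (r * (c * (D + 2 * ?\<delta> n) powr \<alpha>))) \<longlonglongrightarrow> ennreal (r * (c * (D + 2 * 0) powr \<alpha>))"
    using assms D by (intro tendsto_intros tendsto_ennrealI tendsto_powr' lim1) auto
  moreover have "ennreal (r * (c * (D + 2 * 0) powr \<alpha>)) < \<mu> S"
    using S(4) r D assms by (simp add: zeta_def ennreal_mult)
  ultimately have "eventually (\<lambda>n. ennreal (r * (c * (D + 2 * ?\<delta> n) powr \<alpha>)) < \<mu> S) sequentially"
    by (intro order_tendstoD(2))
  moreover have "eventually (\<lambda>n. D + 2 * ?\<delta> n < \<epsilon>) sequentially"
    using order_tendstoD(2)[OF lim1] De by simp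
  ultimately have "eventually (\<lambda>n. ennreal (r * (c * (D + 2 * ?\<delta> n) powr \<alpha>)) < \<mu> S \<and> D + 2 * ?\<delta> n < \<epsilon>) sequentially"
    by eventually_elim simp
  then obtain n where n': "ennreal (r * (c * (D + 2 * ?\<delta> n) powr \<alpha>)) < \<mu> S" "D + 2 * ?\<delta> n < \<epsilon>"
    by (auto simp: eventually_sequentially)
  define \<delta> where "\<delta> = ?\<delta> n"
  have n: "ennreal (r * (c * (D + 2 * \<delta>) powr \<alpha>)) < \<mu> S" "D + 2 * \<delta> < \<epsilon>" "0 < \<delta>"
    using n' by (auto simp: \<delta>_def)
  let ?U = "\<Union>s\<in>S. ball s \<delta>"
  have ediamU: "ediam (closure ?U) \<le> ennreal (D + 2 * \<delta>)"
    using ediam_UN_ball_le[of D S \<delta>] D n by (simp add: ediam_closure)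
  have SU: "S \<subseteq> ?U" using n(3) by force
  have "t * zeta c \<alpha> (closure ?U) \<le> ennreal r * ennreal (c * (D + 2 * \<delta>) powr \<alpha>)"
    unfolding r(1) using assms D n ediamU by (intro mult_left_mono zeta_le) auto
  also have "\<dots> = ennreal (r * (c * (D + 2 * \<delta>) powr \<alpha>))"
    using r assms by (simp add: ennreal_mult)
  also have "\<dots> < \<mu> S" by (rule n(1))
  also have "\<mu> S \<le> \<mu> (closure ?U)"
    using SU closure_subset by (intro measure_over_mono[OF assms(1)]) blast
  finally have "t * zeta c \<alpha> (closure ?U) < \<mu> (closure ?U)" .
  moreover have "ediam (closure ?U) < ennreal \<epsilon>"
    using n(2,3) D(2) by (intro le_less_trans[OF ediamU] ennreal_lessI) auto
  ultimately have "t < federer_sup c \<alpha> \<mu> \<epsilon> y" if "y \<in> ?U" for y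
    using t subsetD[OF closure_subset that] unfolding less_federer_sup_iff[OF assms(2)]
    by (intro conjI exI[of _ "closure ?U"] closed_closure)
  then have "?U \<subseteq> {x. t < federer_sup c \<alpha> \<mu> \<epsilon> x}" by blast
  moreover have "open ?U" by auto
  moreover have "x \<in> ?U" using SU S(2) by blast
  ultimately show "\<exists>T. open T \<and> x \<in> T \<and> T \<subseteq> {x. t < federer_sup c \<alpha> \<mu> \<epsilon> x}"
    by (intro exI[of _ ?U] conjI)
qed

lemma borel_measurable_federer_density:
  assumes "measure_over \<mu>" "0 < c" "0 < \<alpha>"
  shows "federer_density c \<alpha> \<mu> \<in> borel_measurable borel"
proof -
  \<comment> \<open>Monotonicity in the scale reduces the infimum to countably many scales, as
    measurability demands.\<close>
  have "federer_density c \<alpha> \<mu> x = (INF n::nat. federer_sup c \<alpha> \<mu> (1 / real (Suc n)) x)" for x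
    unfolding federer_density_eq
  proof (rule INF_eq)
    fix \<epsilon> :: real assume "\<epsilon> \<in> {0<..}"
    then obtain n where "1 / real (Suc n) < \<epsilon>" using nat_approx_posE by auto
    then show "\<exists>n\<in>UNIV. federer_sup c \<alpha> \<mu> (1 / real (Suc n)) x \<le> federer_sup c \<alpha> \<mu> \<epsilon> x"
      by (intro bexI[of _ n] federer_sup_mono) auto
  next
    fix n :: nat
    show "\<exists>\<epsilon>\<in>{0<..}. federer_sup c \<alpha> \<mu> \<epsilon> x \<le> federer_sup c \<alpha> \<mu> (1 / real (Suc n)) x"
      by (intro bexI[of _ "1 / real (Suc n)"]) auto
  qed
  moreover have "federer_sup c \<alpha> \<mu> \<epsilon> \<in> borel_measurable borel" for \<epsilon>
    by (intro borel_measurableI_greater) (use open_federer_sup_greater[OF assms] in auto)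
  then have "(\<lambda>x. INF n::nat. federer_sup c \<alpha> \<mu> (1 / real (Suc n)) x) \<in> borel_measurable borel"
    by (intro borel_measurable_INF) auto
  ultimately show ?thesis by presburger
qed

section \<open>Upper bound for \<mu> by the Hausdorff measure\<close>

text \<open>Continuity from below for sets that may fail to be measurable. The measurable hulls
  \<open>h n\<close> may fail to increase, but the intersections \<open>g n\<close> of their tails
  do increase, still contain \<open>E n\<close>, and have measure at most
  \<open>\<mu> (h n)\<close>.\<close>

lemma regular_measure_UN_le:
  fixes E :: "nat \<Rightarrow> 'a set"
  assumes mo: "measure_over \<mu>" and "regular_measure \<mu>" and inc: "incseq E" and le: "\<And>n. \<mu> (E n) \<le> a"
  shows "\<mu> (\<Union>n. E n) \<le> a"
proof -
  interpret sigma_algebra UNIV "caratheodory_sets \<mu>"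
    by (rule sigma_algebra_caratheodory_sets[OF mo])
  have "\<forall>n. \<exists>h. h \<in> caratheodory_sets \<mu> \<and> E n \<subseteq> h \<and> \<mu> h = \<mu> (E n)"
    using assms(2) by (auto simp: regular_measure_def)
  then obtain h where h: "\<And>n. h n \<in> caratheodory_sets \<mu>" "\<And>n. E n \<subseteq> h n" "\<And>n. \<mu> (h n) = \<mu> (E n)"
    by metis
  define g where "g n = (\<Inter>m\<in>{n..}. h m)" for n
  have g: "g n \<in> caratheodory_sets \<mu>" for n
    unfolding g_def using h(1) by (intro countable_INT') auto
  have "E n \<subseteq> g n" for n
    using inc h(2) unfolding g_def incseq_def by blast
  then have "\<mu> (\<Union>n. E n) \<le> \<mu> (\<Union>n. g n)"
    by (intro measure_over_mono[OF mo]) blast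
  also have "\<dots> = emeasure (caratheodory_measure \<mu>) (\<Union>n. g n)"
    using g by (subst emeasure_caratheodory_measure[OF mo]) auto
  also have "\<dots> = (SUP n. emeasure (caratheodory_measure \<mu>) (g n))"
  proof (rule SUP_emeasure_incseq[symmetric])
    show "incseq g" unfolding incseq_def g_def by force
  qed (use g in \<open>auto simp: sets_caratheodory_measure[OF mo]\<close>)
  also have "\<dots> \<le> a"
  proof (rule SUP_least)
    fix n
    have "\<mu> (g n) \<le> \<mu> (h n)"
      by (rule measure_over_mono[OF mo]) (auto simp: g_def)
    also have "\<dots> \<le> a" using h(3) le by simp
    finally show "emeasure (caratheodory_measure \<mu>) (g n) \<le> a"
      using g by (simp add: emeasure_caratheodory_measure[OF mo])
  qed
  finally show ?thesis .
qed

lemma ennreal_le_mult_iff: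
  assumes "0 < s"
  shows "a \<le> ennreal s * b \<longleftrightarrow> ennreal (1 / s) * a \<le> b"
proof -
  have 1: "ennreal (1 / s) * (ennreal s * x) = x" "ennreal s * (ennreal (1 / s) * x) = x" for x
    using assms by (simp_all add: mult.assoc[symmetric] ennreal_mult[symmetric])
  show ?thesis
    using mult_left_mono[of a "ennreal s * b" "ennreal (1 / s)"]
      mult_left_mono[of "ennreal (1 / s) * a" b "ennreal s"] by (auto simp: 1)
qed

text \<open>\<open>En n\<close> is the part of \<open>E\<close> on which one scale controls the
  quotients at all points. As \<open>E\<close> is an arbitrary set, regularity stands in for
  measurability in the passage to the union.\<close>

lemma measure_le_hausdorff_measure:
  assumes mo: "measure_over \<mu>" and reg: "regular_measure \<mu>" and c: "0 < c" and s: "0 < (s::real)"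
    and E: "\<And>x. x \<in> E \<Longrightarrow> federer_density c \<alpha> \<mu> x < ennreal s"
  shows "\<mu> E \<le> ennreal s * hausdorff_measure c \<alpha> E"
proof -
  define En where "En n = {x\<in>E. federer_sup c \<alpha> \<mu> (1 / real (Suc n)) x < ennreal s}" for n
  have "E = (\<Union>n. En n)"
  proof
    show "E \<subseteq> (\<Union>n. En n)"
    proof
      fix x assume x: "x \<in> E"
      from E[OF this] obtain \<epsilon> :: real where \<epsilon>: "0 < \<epsilon>" "federer_sup c \<alpha> \<mu> \<epsilon> x < ennreal s"
        by (auto simp: federer_density_eq INF_less_iff)
      obtain n where "1 / real (Suc n) < \<epsilon>" using nat_approx_posE[OF \<epsilon>(1)] by auto
      then have "federer_sup c \<alpha> \<mu> (1 / real (Suc n)) x \<le> federer_sup c \<alpha> \<mu> \<epsilon> x"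
        by (intro federer_sup_mono) auto
      then have "x \<in> En n" using x \<epsilon>(2) unfolding En_def by (auto intro: le_less_trans)
      then show "x \<in> (\<Union>n. En n)" by blast
    qed
  qed (auto simp: En_def)
  moreover have "\<mu> (\<Union>n. En n) \<le> ennreal s * hausdorff_measure c \<alpha> E"
  proof (rule regular_measure_UN_le[OF mo reg])
    show "incseq En"
    proof (rule incseq_SucI)
      fix n
      have "federer_sup c \<alpha> \<mu> (1 / real (Suc (Suc n))) x \<le> federer_sup c \<alpha> \<mu> (1 / real (Suc n)) x" for x
        by (intro federer_sup_mono divide_left_mono) auto
      then show "En n \<subseteq> En (Suc n)" unfolding En_def by (auto intro: le_less_trans)
    qed
    fix n
    \<comment> \<open>Coverings allow diameters equal to \<open>\<delta>\<close>, the suprema only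
      diameters strictly below their scale, so half the scale is taken.\<close>
    define \<delta> where "\<delta> = 1 / real (Suc n) / 2"
    have \<delta>: "0 < \<delta>" "\<delta> < 1 / real (Suc n)" by (auto simp: \<delta>_def field_simps)
    have "ennreal (1 / s) * \<mu> (En n) \<le> hausdorff_premeasure c \<alpha> \<delta> (En n)"
    proof (rule le_hausdorff_premeasure)
      fix F :: "nat \<Rightarrow> 'a set"
      assume F: "\<And>j. closed (F j)" "\<And>j. ediam (F j) \<le> ennreal \<delta>" "En n \<subseteq> (\<Union>j. F j)"
      \<comment> \<open>The bound for \<mu> is known only for sets that meet \<open>En n\<close>;
        the others are emptied.\<close>
      let ?F = "\<lambda>j. if F j \<inter> En n = {} then {} else F j"
      have "\<mu> (En n) \<le> \<mu> (\<Union>j. ?F j)"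
      proof (intro measure_over_mono[OF mo] subsetI)
        fix x assume x: "x \<in> En n"
        then obtain j where "x \<in> F j" using F(3) by blast
        then show "x \<in> (\<Union>j. ?F j)" using x by (intro UN_I[of j]) auto
      qed
      also have "\<dots> \<le> (\<Sum>j. \<mu> (?F j))"
        by (rule measure_over_UN_le[OF mo])
      also have "\<dots> \<le> (\<Sum>j. ennreal s * zeta c \<alpha> (F j))"
      proof (intro suminf_le)
        fix j
        show "\<mu> (?F j) \<le> ennreal s * zeta c \<alpha> (F j)"
        proof (cases "F j \<inter> En n = {}")
          case False
          then obtain x where x: "x \<in> F j" "x \<in> En n" by blast
          then have "\<not> ennreal s < federer_sup c \<alpha> \<mu> (1 / real (Suc n)) x"
            by (auto simp: En_def)
          moreover have "ediam (F j) < ennreal (1 / real (Suc n))"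
            using \<delta> by (intro le_less_trans[OF F(2)] ennreal_lessI) auto
          ultimately show ?thesis
            using x(1) F(1)[of j] False by (auto simp: less_federer_sup_iff[OF c] not_less)
        qed (simp add: measure_over_empty[OF mo])
      qed auto
      also have "\<dots> = ennreal s * (\<Sum>j. zeta c \<alpha> (F j))" by simp
      finally show "ennreal (1 / s) * \<mu> (En n) \<le> (\<Sum>j. zeta c \<alpha> (F j))"
        by (simp add: ennreal_le_mult_iff[OF s])
    qed
    also have "\<dots> \<le> hausdorff_premeasure c \<alpha> \<delta> E"
      by (rule hausdorff_premeasure_mono) (auto simp: En_def)
    also have "\<dots> \<le> hausdorff_measure c \<alpha> E"
      by (rule hausdorff_premeasure_le_measure[OF \<delta>(1)])
    finally show "\<mu> (En n) \<le> ennreal s * hausdorff_measure c \<alpha> E"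
      by (simp add: ennreal_le_mult_iff[OF s])
  qed
  ultimately show ?thesis by simp
qed

section \<open>Vitali covering and the lower bound\<close>

text \<open>Zorn's lemma for disjoint subfamilies \<open>H\<close> such that each set of
  \<open>G\<close> either misses all of \<open>H\<close> or meets a member at least half as large.
  If a maximal one were missed by some set, adding a missed set of more than half the supremal
  diameter would extend it.\<close>

lemma vitali_disjoint_subfamily:
  fixes G :: "'a::metric_space set set"
  assumes pos: "\<And>S. S \<in> G \<Longrightarrow> 0 < ediam S" and bounded: "\<And>S. S \<in> G \<Longrightarrow> ediam S \<le> ennreal D"
  obtains H where "H \<subseteq> G" "disjoint H" "\<And>T. T \<in> G \<Longrightarrow> \<exists>S\<in>H. T \<inter> S \<noteq> {} \<and> ediam T \<le> 2 * ediam S"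
proof -
  define \<Omega> where "\<Omega> = {H. H \<subseteq> G \<and> disjoint H \<and>
    (\<forall>T\<in>G. (\<forall>S\<in>H. T \<inter> S = {}) \<or> (\<exists>S\<in>H. T \<inter> S \<noteq> {} \<and> ediam T \<le> 2 * ediam S))}"
  have "\<exists>M\<in>\<Omega>. \<forall>X\<in>\<Omega>. M \<subseteq> X \<longrightarrow> X = M"
  proof (rule subset_Zorn')
    fix C assume C: "subset.chain \<Omega> C"
    then have sub: "H \<in> \<Omega>" if "H \<in> C" for H
      using that by (auto simp: subset.chain_def)
    have "disjnt S T" if ST: "S \<in> \<Union>C" "T \<in> \<Union>C" "S \<noteq> T" for S T
    proof -
      obtain H1 H2 where H: "H1 \<in> C" "S \<in> H1" "H2 \<in> C" "T \<in> H2" using ST by blast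
      then have "H1 \<subseteq> H2 \<or> H2 \<subseteq> H1" using subset.chain_total[OF C] by blast
      then obtain H where "H \<in> C" "S \<in> H" "T \<in> H" using H by blast
      then show ?thesis using sub[of H] ST(3) by (auto simp: \<Omega>_def pairwise_def)
    qed
    then have "disjoint (\<Union>C)" by (auto simp: pairwise_def)
    moreover have "(\<forall>S\<in>\<Union>C. T \<inter> S = {}) \<or> (\<exists>S\<in>\<Union>C. T \<inter> S \<noteq> {} \<and> ediam T \<le> 2 * ediam S)"
      if T: "T \<in> G" for T
    proof (cases "\<forall>S\<in>\<Union>C. T \<inter> S = {}")
      case False
      then obtain H S where "H \<in> C" "S \<in> H" "T \<inter> S \<noteq> {}" by blast
      then have "\<exists>S\<in>H. T \<inter> S \<noteq> {} \<and> ediam T \<le> 2 * ediam S"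
        using sub[of H] T by (auto simp: \<Omega>_def)
      then show ?thesis using \<open>H \<in> C\<close> by blast
    qed simp
    moreover have "\<Union>C \<subseteq> G" using sub by (auto simp: \<Omega>_def)
    ultimately show "\<Union>C \<in> \<Omega>" by (simp add: \<Omega>_def)
  qed
  then obtain M where M: "M \<in> \<Omega>" "\<And>X. X \<in> \<Omega> \<Longrightarrow> M \<subseteq> X \<Longrightarrow> X = M" by blast
  define K where "K = {T\<in>G. \<forall>S\<in>M. T \<inter> S = {}}"
  have "K = {}"
  proof (rule ccontr)
    assume "K \<noteq> {}"
    then obtain T0 where T0: "T0 \<in> K" by blast
    define B where "B = (SUP T\<in>K. ediam T)"
    have "ediam T0 \<le> B" unfolding B_def by (rule SUP_upper[OF T0])
    then have B0: "0 < B" using pos[of T0] T0 by (auto simp: K_def)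
    have "B \<le> ennreal D" unfolding B_def by (rule SUP_least) (auto simp: K_def bounded)
    then have "B < top" by (rule le_less_trans) simp
    then obtain b where "B = ennreal b" using less_top_ennreal by blast
    with B0 have b: "B = ennreal b" "0 < b" by simp_all
    \<comment> \<open>Strictness needs \<open>B\<close> positive and finite, which the two
      assumptions on \<open>G\<close> provide.\<close>
    have "B < 2 * B"
    proof -
      have "ennreal b < ennreal (b + b)" using b by (intro ennreal_lessI) auto
      also have "\<dots> = ennreal b + ennreal b" using b by (intro ennreal_plus) auto
      finally show ?thesis unfolding b(1) mult_2 .
    qed
    then have "B < (SUP T\<in>K. 2 * ediam T)" by (simp add: B_def SUP_mult_left_ennreal)
    then obtain T1 where T1: "T1 \<in> K" "B < 2 * ediam T1" by (auto simp: less_SUP_iff)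
    have T1G: "T1 \<in> G" "\<And>S. S \<in> M \<Longrightarrow> T1 \<inter> S = {}" using T1 by (auto simp: K_def)
    \<comment> \<open>An empty \<open>T1\<close> would be disjoint from itself and could already
      belong to \<open>M\<close>.\<close>
    have ne: "T1 \<noteq> {}" using pos[OF T1G(1)] by auto
    have "insert T1 M \<in> \<Omega>"
      unfolding \<Omega>_def
    proof (intro CollectI conjI ballI)
      show "insert T1 M \<subseteq> G" using M(1) T1G(1) by (simp add: \<Omega>_def)
      show "disjoint (insert T1 M)"
        using M(1) T1G(2) by (auto simp: \<Omega>_def pairwise_insert disjnt_def)
      fix T assume T: "T \<in> G"
      show "(\<forall>S\<in>insert T1 M. T \<inter> S = {}) \<or> (\<exists>S\<in>insert T1 M. T \<inter> S \<noteq> {} \<and> ediam T \<le> 2 * ediam S)"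
      proof (cases "T \<in> K")
        case True
        then have "ediam T \<le> B" unfolding B_def by (rule SUP_upper)
        then have "ediam T \<le> 2 * ediam T1" using T1(2) by simp
        moreover have "\<forall>S\<in>M. T \<inter> S = {}" using True by (simp add: K_def)
        ultimately show ?thesis by blast
      next
        case False
        then show ?thesis using M(1) T unfolding K_def \<Omega>_def by blast
      qed
    qed
    then have "insert T1 M = M" by (rule M(2)) blast
    then show False using T1G(2)[of T1] ne by blast
  qed
  show ?thesis
  proof (rule that)
    show "M \<subseteq> G" "disjoint M" using M(1) by (auto simp: \<Omega>_def)
    show "\<exists>S\<in>M. T \<inter> S \<noteq> {} \<and> ediam T \<le> 2 * ediam S" if "T \<in> G" for T
    proof -
      have "T \<notin> K" using \<open>K = {}\<close> by blast
      then show ?thesis using M(1) that unfolding K_def \<Omega>_def by blast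
    qed
  qed
qed


text \<open>Disjointness bounds the number of sets of measure above \<open>1 / (n + 1)\<close> by
  \<open>(n + 1) * v\<close>, with \<open>v\<close> the measure of \<open>V\<close>.\<close>

lemma countable_disjoint_positive_measure:
  assumes "H \<subseteq> sets M" "disjoint H" "\<And>S. S \<in> H \<Longrightarrow> 0 < emeasure M S"
    and V: "V \<in> sets M" "emeasure M V < \<infinity>" "\<And>S. S \<in> H \<Longrightarrow> S \<subseteq> V"
  shows "countable H"
proof -
  define K where "K n = {S\<in>H. ennreal (1 / real (Suc n)) < emeasure M S}" for n
  have "finite (K n)" for n
  proof (rule ccontr)
    assume inf: "infinite (K n)"
    obtain v where v: "emeasure M V = ennreal v" "0 \<le> v" using V(2) by (cases "emeasure M V") auto
    obtain N :: nat where N: "v * real (Suc n) < real N" using reals_Archimedean2 by blast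
    obtain F where F: "finite F" "card F = N" "F \<subseteq> K n"
      using infinite_arbitrarily_large[OF inf] by blast
    have FH: "F \<subseteq> H" using F(3) by (auto simp: K_def)
    have "disjoint F" using assms(2) FH by (rule pairwise_subset)
    then have disj: "disjoint_family_on (\<lambda>S. S) F"
      by (auto simp: disjoint_family_on_def pairwise_def disjnt_def)
    have "ennreal (real N * (1 / real (Suc n))) = (\<Sum>S\<in>F. ennreal (1 / real (Suc n)))"
      using F(2) by (simp add: ennreal_of_nat_eq_real_of_nat ennreal_mult[symmetric])
    also have "\<dots> \<le> (\<Sum>S\<in>F. emeasure M S)"
      using F(3) by (intro sum_mono) (auto simp: K_def less_imp_le)
    also have "\<dots> = emeasure M (\<Union>S\<in>F. S)"
      using FH assms(1) F(1) disj by (intro sum_emeasure) auto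
    also have "\<dots> \<le> emeasure M V"
      using FH V by (intro emeasure_mono) auto
    finally have "real N * (1 / real (Suc n)) \<le> v"
      using v by simp
    then show False using N by (simp add: field_simps)
  qed
  moreover have "H = (\<Union>n. K n)"
  proof
    show "H \<subseteq> (\<Union>n. K n)"
    proof
      fix S assume S: "S \<in> H"
      obtain q where q: "0 < q" "ennreal q < emeasure M S"
      proof -
        obtain y where "0 < y" "y < emeasure M S" using dense[OF assms(3)[OF S]] by blast
        then show ?thesis using that by (cases y) (auto simp: less_top)
      qed
      obtain n where "1 / real (Suc n) < q" using nat_approx_posE[OF q(1)] by auto
      then have "ennreal (1 / real (Suc n)) < emeasure M S"
        by (intro less_trans[OF ennreal_lessI[OF q(1)] q(2)])
      then show "S \<in> (\<Union>n. K n)" using S unfolding K_def by blast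
    qed
  qed (auto simp: K_def)
  ultimately show ?thesis by (simp add: countable_finite)
qed

text \<open>\<open>from_nat_into\<close> alone repeats members when \<open>H\<close> is finite.
  Indices outside the image of \<open>to_nat_on\<close> get the empty set instead, which keeps the
  indexed family disjoint and adds nothing to sums of \<open>zeta\<close> or \<mu>.\<close>

lemma countable_disjoint_enumeration:
  assumes "countable H" "disjoint H"
  obtains e :: "nat \<Rightarrow> 'a set" where "disjoint_family e" "H \<subseteq> range e" "range e \<subseteq> insert {} H"
proof
  let ?e = "\<lambda>n. if n \<in> to_nat_on H ` H then from_nat_into H n else {}"
  show "disjoint_family ?e"
  proof (unfold disjoint_family_on_def, intro ballI impI)
    fix m n :: nat assume "m \<noteq> n"
    show "?e m \<inter> ?e n = {}"
    proof (cases "m \<in> to_nat_on H ` H \<and> n \<in> to_nat_on H ` H")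
      case True
      then obtain S T where ST: "S \<in> H" "m = to_nat_on H S" "T \<in> H" "n = to_nat_on H T" by blast
      then have "S \<noteq> T" using \<open>m \<noteq> n\<close> by blast
      then have "S \<inter> T = {}" using assms(2) ST by (auto simp: pairwise_def disjnt_def)
      then show ?thesis using ST assms(1) by simp
    qed auto
  qed
  show "H \<subseteq> range ?e"
  proof
    fix S assume "S \<in> H"
    then have "S = ?e (to_nat_on H S)" using assms(1) by simp
    then show "S \<in> range ?e" by blast
  qed
  show "range ?e \<subseteq> insert {} H"
    using assms(1) by auto
qed

text \<open>The factor is 2 + 1 + 2: from \<open>x\<close> through its set to \<open>S\<close>,
  across \<open>S\<close>, and through the other set to \<open>y\<close>.\<close>

lemma ediam_neighbours_le:
  assumes "\<And>T. T \<in> \<T> \<Longrightarrow> T \<inter> S \<noteq> {} \<and> ediam T \<le> 2 * ediam S"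
  shows "ediam (\<Union>\<T>) \<le> 5 * ediam S"
proof (cases "ediam S = \<infinity>")
  case False
  then obtain D where D: "ediam S = ennreal D" "0 \<le> D" by (cases "ediam S") auto
  have five: "5 * ediam S = ennreal (5 * D)"
    using D by (simp add: ennreal_mult)
  have T: "ediam T \<le> ennreal (2 * D)" if "T \<in> \<T>" for T
    using assms[OF that] D by (simp add: ennreal_mult)
  show ?thesis
    unfolding five
  proof (intro ediam_le ennreal_leI)
    fix x y assume "x \<in> \<Union>\<T>" "y \<in> \<Union>\<T>"
    then obtain T T' where TT: "T \<in> \<T>" "x \<in> T" "T' \<in> \<T>" "y \<in> T'" by blast
    then obtain s s' where s: "s \<in> T" "s \<in> S" "s' \<in> T'" "s' \<in> S" using assms by blast
    have "dist x s \<le> 2 * D" "dist s' y \<le> 2 * D" "dist s s' \<le> D"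
      using ediam_le_real[OF _ T[OF TT(1)] TT(2) s(1)] ediam_le_real[OF _ T[OF TT(3)] s(3) TT(4)]
        ediam_le_real[OF D(2) _ s(2,4)] D by simp_all
    then show "dist x y \<le> 5 * D"
      using dist_triangle[of x y s] dist_triangle[of s y s'] by simp
  qed
qed (simp add: ennreal_mult_top)

text \<open>Only the sets of a disjoint Vitali subfamily need to be counted with their true size: finitely
  many of them leave a remainder of \<open>E\<close> that is covered by the fivefold enlargements of the others,
  whose total size is the tail of a convergent series.\<close>

lemma hausdorff_measure_le_open:
  fixes \<mu> :: "'a::metric_space set \<Rightarrow> ennreal"
  assumes mo: "measure_over \<mu>" and bm: "borel_measure \<mu>" and c: "0 < c" and \<alpha>: "0 < \<alpha>" and s: "0 < (s::real)"
    and V: "open V" "E \<subseteq> V" "\<mu> V < \<infinity>"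
    and E: "\<And>x. x \<in> E \<Longrightarrow> ennreal s < federer_density c \<alpha> \<mu> x"
    and atomless: "\<And>x. x \<in> E \<Longrightarrow> \<mu> {x} = 0"
  shows "ennreal s * hausdorff_measure c \<alpha> E \<le> \<mu> V"
proof -
  have bor: "S \<in> sets borel \<Longrightarrow> S \<in> caratheodory_sets \<mu>" for S
    using bm by (auto simp: borel_measure_def)
  have "hausdorff_premeasure c \<alpha> \<delta> E \<le> ennreal (1 / s) * \<mu> V" if \<delta>: "0 < \<delta>" for \<delta>
  proof -
    \<comment> \<open>Diameters are at most \<open>\<delta> / 5\<close> so that fivefold
      enlargements remain admissible at scale \<open>\<delta>\<close>. Positive diameter is what the
      Vitali selection asks for.\<close>
    define G where "G = {S. closed S \<and> S \<subseteq> V \<and> 0 < ediam S \<and> ediam S \<le> ennreal (\<delta> / 5) \<and>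
      ennreal s * zeta c \<alpha> S < \<mu> S}"
    have fine: "\<exists>S\<in>G. x \<in> S \<and> S \<subseteq> W" if x: "x \<in> E" "x \<in> W" "open W" for x W
    proof -
      have "open (V \<inter> W)" "x \<in> V \<inter> W" using x V by auto
      then obtain r where r: "0 < r" "ball x r \<subseteq> V \<inter> W" by (meson open_contains_ball)
      define \<epsilon> where "\<epsilon> = min r (\<delta> / 5)"
      have \<epsilon>: "0 < \<epsilon>" "\<epsilon> \<le> r" "\<epsilon> \<le> \<delta> / 5" using r \<delta> by (auto simp: \<epsilon>_def)
      have "federer_density c \<alpha> \<mu> x \<le> federer_sup c \<alpha> \<mu> \<epsilon> x"
        unfolding federer_density_eq using \<epsilon>(1) by (intro INF_lower) auto
      then have "ennreal s < federer_sup c \<alpha> \<mu> \<epsilon> x"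
        by (rule less_le_trans[OF E[OF x(1)]])
      then obtain S where S: "closed S" "x \<in> S" "ediam S < ennreal \<epsilon>" "ennreal s * zeta c \<alpha> S < \<mu> S"
        by (auto simp: less_federer_sup_iff[OF c])
      have "S \<subseteq> ball x r"
      proof
        fix y assume "y \<in> S"
        then have "ennreal (dist x y) < ennreal \<epsilon>"
          by (rule le_less_trans[OF dist_le_ediam[OF S(2)] S(3)])
        then show "y \<in> ball x r" using \<epsilon>(2) by (simp add: ennreal_less_iff)
      qed
      \<comment> \<open>A one-point \<open>S\<close> would have \<open>\<mu> S = 0\<close>, against
        the strict inequality for \<open>S\<close>.\<close>
      moreover have "ediam S \<noteq> 0"
      proof
        assume "ediam S = 0"
        then have "S = {x}" using S(2) by (rule ediam_zeroD)
        then show False using S(4) atomless[OF x(1)] by simp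
      qed
      moreover have "ediam S \<le> ennreal (\<delta> / 5)"
        using S(3) \<epsilon>(3) by (intro order_trans[OF less_imp_le ennreal_leI])
      ultimately have "S \<in> G" "S \<subseteq> W" using S r(2) by (auto simp: G_def zero_less_iff_neq_zero)
      then show ?thesis using S(2) by blast
    qed
    obtain H where H: "H \<subseteq> G" "disjoint H" "\<And>T. T \<in> G \<Longrightarrow> \<exists>S\<in>H. T \<inter> S \<noteq> {} \<and> ediam T \<le> 2 * ediam S"
      by (rule vitali_disjoint_subfamily[of G "\<delta> / 5"]) (auto simp: G_def)
    have HG: "closed S" "S \<subseteq> V" "ediam S \<le> ennreal (\<delta> / 5)" "ennreal s * zeta c \<alpha> S < \<mu> S" if "S \<in> H" for S
      using that H(1) by (auto simp: G_def)
    let ?M = "caratheodory_measure \<mu>"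
    have em: "emeasure ?M S = \<mu> S" if "S \<in> sets borel" for S
      using that by (simp add: emeasure_caratheodory_measure[OF mo] bor)
    have "countable H"
    proof (rule countable_disjoint_positive_measure)
      show "H \<subseteq> sets ?M" using HG(1) by (auto simp: sets_caratheodory_measure[OF mo] intro!: bor)
      show "0 < emeasure ?M S" if "S \<in> H" for S
        using HG(1,4)[OF that] by (subst em) (auto intro: le_less_trans)
      show "V \<in> sets ?M" using V by (auto simp: sets_caratheodory_measure[OF mo] intro!: bor)
      show "emeasure ?M V < \<infinity>" using V by (simp add: em)
    qed (use H HG in auto)
    then obtain e :: "nat \<Rightarrow> 'a set" where e: "disjoint_family e" "H \<subseteq> range e" "range e \<subseteq> insert {} H"
      using H(2) by (rule countable_disjoint_enumeration)
    have eH: "e j = {} \<or> e j \<in> H" for j using e(3) by auto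
    have e': "closed (e j)" "e j \<subseteq> V" "ediam (e j) \<le> ennreal (\<delta> / 5)" "ennreal s * zeta c \<alpha> (e j) \<le> \<mu> (e j)" for j
      using eH[of j] HG[of "e j"] by auto
    have "ennreal s * (\<Sum>j. zeta c \<alpha> (e j)) = (\<Sum>j. ennreal s * zeta c \<alpha> (e j))" by simp
    also have "\<dots> \<le> (\<Sum>j. emeasure ?M (e j))"
      using e' by (intro suminf_le) (auto simp: em)
    also have "\<dots> = emeasure ?M (\<Union>j. e j)"
      using e(1) e'(1) by (intro suminf_emeasure) (auto simp: sets_caratheodory_measure[OF mo] intro!: bor)
    also have "\<dots> \<le> emeasure ?M V"
      using e'(2) V by (intro emeasure_mono) (auto simp: sets_caratheodory_measure[OF mo] intro!: bor)
    also have "\<dots> = \<mu> V" using V by (simp add: em)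
    finally have sum_le: "(\<Sum>j. zeta c \<alpha> (e j)) \<le> ennreal (1 / s) * \<mu> V"
      using s ennreal_le_mult_iff[of "1 / s" "\<Sum>j. zeta c \<alpha> (e j)" "\<mu> V"] by simp
    \<comment> \<open>The closure makes the enlargement admissible in coverings and leaves its
      diameter unchanged.\<close>
    define W where "W S = closure (\<Union>{T\<in>G. T \<inter> S \<noteq> {} \<and> ediam T \<le> 2 * ediam S})" for S
    have W5: "ediam (W S) \<le> 5 * ediam S" for S
      unfolding W_def ediam_closure by (rule ediam_neighbours_le) simp
    have \<zeta>W: "zeta c \<alpha> (W S) \<le> ennreal (5 powr \<alpha>) * zeta c \<alpha> S" for S
      using W5[of S] c \<alpha> by (intro zeta_scale_le) auto
    have "hausdorff_premeasure c \<alpha> \<delta> E \<le> (\<Sum>j. zeta c \<alpha> (e j))"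
    proof (rule le_add_suminf_tail_ennreal)
      have "(\<Sum>j. zeta c \<alpha> (e j)) < \<infinity>"
        using sum_le V(3) by (auto simp: ennreal_mult_less_top intro: le_less_trans)
      then show "(\<Sum>j. ennreal (5 powr \<alpha>) * zeta c \<alpha> (e j)) < \<infinity>"
        by (simp add: ennreal_mult_less_top)
      fix n
      define F where "F j = (if j < n then e j else W (e j))" for j
      have "hausdorff_premeasure c \<alpha> \<delta> E \<le> (\<Sum>j. zeta c \<alpha> (F j))"
      proof (rule hausdorff_premeasure_le)
        show "closed (F j)" for j by (simp add: F_def e' W_def)
        show "ediam (F j) \<le> ennreal \<delta>" for j
        proof (cases "j < n")
          case True
          have "ediam (e j) \<le> ennreal \<delta>"
            using \<delta> by (intro order_trans[OF e'(3)] ennreal_leI) auto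
          then show ?thesis using True by (simp add: F_def)
        next
          case False
          have "ediam (W (e j)) \<le> 5 * ennreal (\<delta> / 5)"
            by (rule order_trans[OF W5 mult_left_mono[OF e'(3)]]) simp
          also have "\<dots> = ennreal \<delta>"
            using \<delta> ennreal_mult[of 5 "\<delta> / 5"] by simp
          finally show ?thesis using False by (simp add: F_def)
        qed
        show "E \<subseteq> (\<Union>j. F j)"
        proof
          fix x assume x: "x \<in> E"
          show "x \<in> (\<Union>j. F j)"
          proof (cases "x \<in> (\<Union>j<n. e j)")
            case True
            then obtain j where "j < n" "x \<in> e j" by blast
            then show ?thesis by (intro UN_I[of j]) (auto simp: F_def)
          next
            case False
            \<comment> \<open>A set \<open>T\<close> of \<open>G\<close> around \<open>x\<close>
              avoids the first \<open>n\<close> selected sets, so the selected set that meets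
              \<open>T\<close> has index at least \<open>n\<close>, and its enlargement contains
              \<open>x\<close>.\<close>
            have "open (- (\<Union>j<n. e j))" using e'(1) by (auto intro!: closed_UN)
            then obtain T where T: "T \<in> G" "x \<in> T" "T \<subseteq> - (\<Union>j<n. e j)"
              using fine[OF x, of "- (\<Union>j<n. e j)"] False by auto
            obtain S where S: "S \<in> H" "T \<inter> S \<noteq> {}" "ediam T \<le> 2 * ediam S" using H(3)[OF T(1)] by blast
            obtain j where j: "S = e j" using e(2) S(1) by blast
            have "\<not> j < n" using T(3) S(2) j by blast
            moreover have "x \<in> W (e j)"
              unfolding W_def using S T j by (intro subsetD[OF closure_subset]) blast
            ultimately show ?thesis by (intro UN_I[of j]) (auto simp: F_def)
          qed
        qed
      qed
      also have "\<dots> = (\<Sum>j<n. zeta c \<alpha> (F j)) + (\<Sum>j. zeta c \<alpha> (F (j + n)))"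
        by (simp add: suminf_offset[of "\<lambda>j. zeta c \<alpha> (F j)" n])
      also have "\<dots> \<le> (\<Sum>j. zeta c \<alpha> (e j)) + (\<Sum>j. ennreal (5 powr \<alpha>) * zeta c \<alpha> (e (j + n)))"
      proof (rule add_mono)
        have "(\<Sum>j<n. zeta c \<alpha> (F j)) = (\<Sum>j<n. zeta c \<alpha> (e j))"
          by (simp add: F_def)
        also have "\<dots> \<le> (\<Sum>j. zeta c \<alpha> (e j))"
          by (intro sum_le_suminf) auto
        finally show "(\<Sum>j<n. zeta c \<alpha> (F j)) \<le> (\<Sum>j. zeta c \<alpha> (e j))" .
        show "(\<Sum>j. zeta c \<alpha> (F (j + n))) \<le> (\<Sum>j. ennreal (5 powr \<alpha>) * zeta c \<alpha> (e (j + n)))"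
          using \<zeta>W by (intro suminf_le) (auto simp: F_def)
      qed
      finally show "hausdorff_premeasure c \<alpha> \<delta> E \<le>
        (\<Sum>j. zeta c \<alpha> (e j)) + (\<Sum>j. ennreal (5 powr \<alpha>) * zeta c \<alpha> (e (j + n)))" .
    qed
    then show ?thesis using sum_le by (rule order_trans)
  qed
  then have "hausdorff_measure c \<alpha> E \<le> ennreal (1 / s) * \<mu> V"
    by (rule hausdorff_measure_le)
  then show ?thesis
    using s ennreal_le_mult_iff[of "1 / s" "hausdorff_measure c \<alpha> E" "\<mu> V"] by simp
qed

section \<open>Density representation\<close>

lemma ennreal_eq_0_if_le_small_multiples:
  fixes a v :: ennreal
  assumes "v < \<infinity>" and le: "\<And>s::real. 0 < s \<Longrightarrow> a \<le> ennreal s * v"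
  shows "a = 0"
proof -
  obtain r where r: "v = ennreal r" "0 \<le> r" using assms(1) by (cases v) auto
  have "a \<le> 0"
  proof (rule ennreal_le_epsilon)
    fix e :: real assume e: "0 < e"
    \<comment> \<open>Dividing by \<open>r + 1\<close> in place of \<open>r\<close> covers the case
      \<open>r = 0\<close>.\<close>
    have "a \<le> ennreal (e / (r + 1)) * v" using e r by (intro le) auto
    also have "\<dots> = ennreal (e / (r + 1) * r)"
      unfolding r(1) using e r by (intro ennreal_mult[symmetric]) auto
    also have "\<dots> \<le> ennreal e"
      using e r by (intro ennreal_leI) (simp add: field_simps)
    finally show "a \<le> 0 + ennreal e" by simp
  qed
  then show ?thesis by simp
qed

lemma ennreal_le_if_le_multiples:
  fixes a v :: ennreal
  assumes le: "\<And>t::real. 1 < t \<Longrightarrow> a \<le> ennreal t * v"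
  shows "a \<le> v"
proof (rule ennreal_le_epsilon)
  fix e :: real assume e: "0 < e" and "v < top"
  then obtain r where r: "v = ennreal r" "0 \<le> r" by (cases v) auto
  have pos: "0 < e / (r + 1)" using e r by simp
  have "a \<le> ennreal (1 + e / (r + 1)) * v" using pos by (intro le) linarith
  also have "\<dots> = ennreal ((1 + e / (r + 1)) * r)"
    unfolding r(1) using pos r by (intro ennreal_mult[symmetric]) linarith+
  also have "\<dots> \<le> ennreal (r + e)"
  proof (rule ennreal_leI)
    have "e / (r + 1) * r \<le> e" using e r by (simp add: field_simps)
    then show "(1 + e / (r + 1)) * r \<le> r + e" by (simp add: distrib_right)
  qed
  also have "\<dots> = v + ennreal e" using e r by simp
  finally show "a \<le> v + ennreal e" .
qed

lemma powr_slice: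
  assumes "1 < (t::real)" "0 < r"
  shows "\<exists>k::int. t powr real_of_int k < r \<and> r \<le> t powr real_of_int (k + 1)"
proof -
  \<comment> \<open>The ceiling gives slices that are open below and closed above, matching the sets
    \<open>L k\<close> later on.\<close>
  define k where "k = \<lceil>log t r\<rceil> - 1"
  have "real_of_int k < log t r" "log t r \<le> real_of_int (k + 1)"
    unfolding k_def by linarith+
  then show ?thesis
    using assms by (intro exI[of _ k]) (simp add: less_log_iff log_le_iff)
qed

text \<open>A comparison principle free of geometry: on a slice where \<open>f\<close> varies by at
  most the factor \<open>t\<close>, both \<open>N\<close> and the density measure are comparable to
  a constant times \<open>M\<close>, at the price of powers of \<open>t\<close>. Where
  \<open>f\<close> is 0 or infinite, both vanish.\<close>

lemma emeasure_eq_density_if_level_bounds: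
  assumes sets: "sets N = sets M" and f [measurable]: "f \<in> borel_measurable M" and A [measurable]: "A \<in> sets M"
    and upper: "\<And>B s. B \<in> sets M \<Longrightarrow> B \<subseteq> A \<Longrightarrow> 0 < (s::real) \<Longrightarrow> (\<And>x. x \<in> B \<Longrightarrow> f x < ennreal s)
      \<Longrightarrow> emeasure N B \<le> ennreal s * emeasure M B"
    and lower: "\<And>B s. B \<in> sets M \<Longrightarrow> B \<subseteq> A \<Longrightarrow> 0 < (s::real) \<Longrightarrow> (\<And>x. x \<in> B \<Longrightarrow> ennreal s < f x)
      \<Longrightarrow> ennreal s * emeasure M B \<le> emeasure N B"
    and zero: "emeasure N {x\<in>A. f x = 0} = 0"
    and inf: "emeasure N {x\<in>A. f x = \<infinity>} = 0" "emeasure M {x\<in>A. f x = \<infinity>} = 0"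
  shows "emeasure N A = emeasure (density M f) A"
proof -
  have AM: "A \<subseteq> space M" by (rule sets.sets_into_space[OF A])
  have restr: "{x\<in>A. P x} \<in> sets M" if "{x\<in>space M. P x} \<in> sets M" for P
  proof -
    have "{x\<in>A. P x} = A \<inter> {x\<in>space M. P x}" using AM by auto
    then show ?thesis using that by simp
  qed
  define Z where "Z = {x\<in>A. f x = 0}"
  define I where "I = {x\<in>A. f x = \<infinity>}"
  have Z [measurable]: "Z \<in> sets M" unfolding Z_def by (rule restr) measurable
  have I [measurable]: "I \<in> sets M" unfolding I_def by (rule restr) measurable
  let ?D = "density M f"
  have ZN: "Z \<union> I \<in> null_sets N"
    using zero inf Z I by (intro null_sets.Un null_setsI) (auto simp: sets Z_def I_def)
  have "emeasure ?D Z = (\<integral>\<^sup>+ x. f x * indicator Z x \<partial>M)"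
    by (rule emeasure_density) auto
  also have "\<dots> = (\<integral>\<^sup>+ x. 0 \<partial>M)"
    by (intro nn_integral_cong) (auto simp: Z_def indicator_def)
  finally have "emeasure ?D Z = 0" by simp
  \<comment> \<open>The integrand is infinite here, but the set is null for
    \<open>M\<close>.\<close>
  moreover have "emeasure ?D I = 0"
    using inf I by (subst emeasure_density) (auto simp: I_def intro!: nn_integral_null_set null_setsI)
  ultimately have ZD: "Z \<union> I \<in> null_sets ?D"
    using Z I by (intro null_sets.Un null_setsI) auto
  have main: "emeasure N A \<le> ennreal (t\<^sup>2) * emeasure ?D A" "emeasure ?D A \<le> ennreal t * emeasure N A"
    if t: "1 < t" for t :: real
  proof -
    let ?a = "\<lambda>k::int. t powr real_of_int k"
    define L where "L k = {x\<in>A. ennreal (?a k) < f x \<and> f x \<le> ennreal (?a (k + 1))}" for k :: int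
    have L [measurable]: "L k \<in> sets M" for k
      unfolding L_def by (rule restr) measurable
    have LA: "L k \<subseteq> A" for k by (auto simp: L_def)
    have succ: "?a (k + 1) = t * ?a k" for k
      using t by (simp add: powr_add)
    have mono: "?a j \<le> ?a k" if "j \<le> k" for j k
      using that t by (intro powr_mono) auto
    have disj: "disjoint_family L"
    proof -
      have "L j \<inter> L k = {}" if "j < k" for j k
      proof -
        have le: "ennreal (?a (j + 1)) \<le> ennreal (?a k)" using that by (intro ennreal_leI mono) auto
        have "f x \<le> ennreal (?a k)" if "x \<in> L j" for x
          using that unfolding L_def by (intro order_trans[OF _ le]) blast
        then show ?thesis unfolding L_def by (blast dest: leD)
      qed
      then show ?thesis unfolding disjoint_family_on_def by (metis Int_commute linorder_neqE)
    qed
    have A_eq: "A = (\<Union>k. L k) \<union> (Z \<union> I)"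
    proof
      show "A \<subseteq> (\<Union>k. L k) \<union> (Z \<union> I)"
      proof
        fix x assume x: "x \<in> A"
        show "x \<in> (\<Union>k. L k) \<union> (Z \<union> I)"
        proof (cases "f x")
          case (real r)
          show ?thesis
          proof (cases "r = 0")
            case True
            then show ?thesis using x real by (simp add: Z_def)
          next
            case False
            then obtain k where "?a k < r" "r \<le> ?a (k + 1)"
              using powr_slice[OF t, of r] real by auto
            then have "x \<in> L k"
              using x real unfolding L_def by (auto simp: ennreal_less_iff intro: ennreal_leI)
            then show ?thesis by blast
          qed
        next
          case top
          then show ?thesis using x by (simp add: I_def)
        qed
      qed
    qed (auto simp: L_def Z_def I_def)
    \<comment> \<open>The slices are indexed by \<open>int\<close>, so the countable sum is written
      as an integral over \<open>count_space\<close>.\<close>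
    have sum: "emeasure P A = (\<integral>\<^sup>+ k. emeasure P (L k) \<partial>count_space UNIV)"
      if "sets P = sets M" "Z \<union> I \<in> null_sets P" for P
    proof -
      have "emeasure P A = emeasure P (\<Union>k. L k)"
        using that by (subst A_eq, intro emeasure_Un_null_set) auto
      also have "\<dots> = (\<integral>\<^sup>+ k. emeasure P (L k) \<partial>count_space UNIV)"
        using disj that by (intro emeasure_UN_countable) auto
      finally show ?thesis .
    qed
    have D_eq: "emeasure ?D (L k) = (\<integral>\<^sup>+ x. f x * indicator (L k) x \<partial>M)" for k
      by (rule emeasure_density) auto
    have "emeasure N (L k) \<le> ennreal (t\<^sup>2) * emeasure ?D (L k)" for k
    proof -
      \<comment> \<open>\<open>upper\<close> wants a strict bound while \<open>f\<close> may equal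
        \<open>?a (k + 1)\<close>, so one more factor \<open>t\<close> is spent; hence the
        square.\<close>
      have "emeasure N (L k) \<le> ennreal (t * ?a (k + 1)) * emeasure M (L k)"
      proof (rule upper[OF L LA])
        fix x assume "x \<in> L k"
        moreover have "ennreal (?a (k + 1)) < ennreal (t * ?a (k + 1))"
          using t by (intro ennreal_lessI) auto
        ultimately show "f x < ennreal (t * ?a (k + 1))"
          by (auto simp: L_def intro: le_less_trans)
      qed (use t in auto)
      also have "\<dots> = ennreal (t\<^sup>2) * (ennreal (?a k) * emeasure M (L k))"
        unfolding succ mult.assoc[symmetric]
        using t by (subst ennreal_mult[symmetric]) (auto simp: power2_eq_square mult.assoc)
      also have "ennreal (?a k) * emeasure M (L k) = (\<integral>\<^sup>+ x. ennreal (?a k) * indicator (L k) x \<partial>M)"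
        by (simp add: nn_integral_cmult_indicator)
      also have "\<dots> \<le> emeasure ?D (L k)"
        unfolding D_eq by (intro nn_integral_mono) (auto simp: L_def indicator_def less_imp_le)
      finally show ?thesis by (simp add: mult_left_mono)
    qed
    then have "(\<integral>\<^sup>+ k. emeasure N (L k) \<partial>count_space UNIV)
        \<le> (\<integral>\<^sup>+ k. ennreal (t\<^sup>2) * emeasure ?D (L k) \<partial>count_space UNIV)"
      by (intro nn_integral_mono)
    then show "emeasure N A \<le> ennreal (t\<^sup>2) * emeasure ?D A"
      using sum[OF sets ZN] sum[of ?D] ZD by (simp add: nn_integral_cmult)
    have "emeasure ?D (L k) \<le> ennreal t * emeasure N (L k)" for k
    proof -
      have "emeasure ?D (L k) \<le> (\<integral>\<^sup>+ x. ennreal (?a (k + 1)) * indicator (L k) x \<partial>M)"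
        unfolding D_eq by (intro nn_integral_mono) (auto simp: L_def indicator_def)
      also have "\<dots> = ennreal t * (ennreal (?a k) * emeasure M (L k))"
        unfolding succ mult.assoc[symmetric]
        using t by (subst ennreal_mult[symmetric]) (auto simp: nn_integral_cmult_indicator)
      also have "\<dots> \<le> ennreal t * emeasure N (L k)"
        using t by (intro mult_left_mono lower[OF L LA]) (auto simp: L_def)
      finally show ?thesis .
    qed
    then have "(\<integral>\<^sup>+ k. emeasure ?D (L k) \<partial>count_space UNIV)
        \<le> (\<integral>\<^sup>+ k. ennreal t * emeasure N (L k) \<partial>count_space UNIV)"
      by (intro nn_integral_mono)
    then show "emeasure ?D A \<le> ennreal t * emeasure N A"
      using sum[OF sets ZN] sum[of ?D] ZD by (simp add: nn_integral_cmult)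
  qed
  show ?thesis
  proof (rule antisym)
    show "emeasure N A \<le> emeasure ?D A"
    proof (rule ennreal_le_if_le_multiples)
      fix t :: real assume "1 < t"
      \<comment> \<open>Using the root of \<open>t\<close> turns the squared loss into
        \<open>t\<close>.\<close>
      then show "emeasure N A \<le> ennreal t * emeasure ?D A"
        using main(1)[of "sqrt t"] by simp
    qed
    show "emeasure ?D A \<le> emeasure N A"
      by (rule ennreal_le_if_le_multiples) (rule main(2))
  qed
qed

section \<open>Borel restrictions and the integral formula\<close>

text \<open>The Caratheodory sigma-algebras of \<mu> and of the Hausdorff measure may differ.
  Pushing forward along the identity to \<open>borel\<close> gives both measures the same measurable
  sets.\<close>

definition borel_restriction :: "('a::topological_space set \<Rightarrow> ennreal) \<Rightarrow> 'a measure" where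
  "borel_restriction \<mu> = distr (caratheodory_measure \<mu>) borel (\<lambda>x. x)"

lemma sets_borel_restriction [simp]: "sets (borel_restriction \<mu>) = sets borel"
  by (simp add: borel_restriction_def)

lemma borel_measurable_caratheodory_measure:
  assumes "measure_over \<mu>" "borel_measure \<mu>"
  shows "(\<lambda>x. x) \<in> borel_measurable (caratheodory_measure \<mu>)"
  using assms
  by (auto simp: measurable_def space_caratheodory_measure sets_caratheodory_measure borel_measure_def)

lemma emeasure_borel_restriction:
  assumes "measure_over \<mu>" "borel_measure \<mu>" "B \<in> sets borel"
  shows "emeasure (borel_restriction \<mu>) B = \<mu> B"
  using assms borel_measurable_caratheodory_measure[OF assms(1,2)]
  by (auto simp: borel_restriction_def emeasure_distr space_caratheodory_measure
      emeasure_caratheodory_measure borel_measure_def)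

lemma nn_integral_borel_restriction:
  assumes "measure_over \<mu>" "borel_measure \<mu>" "f \<in> borel_measurable borel"
  shows "(\<integral>\<^sup>+ x. f x \<partial>borel_restriction \<mu>) = (\<integral>\<^sup>+ x. f x \<partial>caratheodory_measure \<mu>)"
  unfolding borel_restriction_def
  by (rule nn_integral_distr[OF borel_measurable_caratheodory_measure[OF assms(1,2)]]) (simp add: assms(3))

theorem theorem5p2:
  fixes \<mu> :: "'a::metric_space set \<Rightarrow> ennreal"
    and c \<alpha> :: real
    and A :: "'a set"
  assumes "measure_over \<mu>"
    and "\<alpha> > 0" and "c > 0"
    and "regular_measure \<mu>" and "borel_measure \<mu>"
    and "covers_finely (closed_family \<mu> (zeta c \<alpha>)) A"
    and "A \<in> sets borel"
    and "\<exists>\<U>. countable \<U> \<and> A \<subseteq> \<Union>\<U> \<and> (\<forall>U\<in>\<U>. open U \<and> \<mu> U < \<infinity>)"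
    and "sigma_finite_wrt (hausdorff_measure c \<alpha>) {x\<in>A. federer_density c \<alpha> \<mu> x = 0}"
    and "abs_continuous_on A \<mu> (hausdorff_measure c \<alpha>)"
  shows "federer_density c \<alpha> \<mu> \<in> borel_measurable (restrict_space borel A) \<and>
    (\<forall>B\<in>sets borel. B \<subseteq> A \<longrightarrow>
      \<mu> B = (\<integral>\<^sup>+ x\<in>B. federer_density c \<alpha> \<mu> x
                \<partial>caratheodory_measure (hausdorff_measure c \<alpha>)))"
proof -
  note mo = \<open>measure_over \<mu>\<close> and \<alpha> = \<open>\<alpha> > 0\<close> and c = \<open>c > 0\<close>
    and reg = \<open>regular_measure \<mu>\<close> and bm = \<open>borel_measure \<mu>\<close> and A = \<open>A \<in> sets borel\<close>
  let ?H = "hausdorff_measure c \<alpha> :: 'a set \<Rightarrow> ennreal"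
  let ?d = "federer_density c \<alpha> \<mu>"
  let ?M = "borel_restriction ?H" and ?N = "borel_restriction \<mu>"
  have ac: "\<mu> S = 0" if "S \<subseteq> A" "?H S = 0" for S
    using assms(10) that by (auto simp: abs_continuous_on_def)
  have d [measurable]: "?d \<in> borel_measurable borel"
    by (rule borel_measurable_federer_density[OF mo c \<alpha>])
  have emM: "emeasure ?M B = ?H B" if "B \<in> sets borel" for B
    using that by (rule emeasure_borel_restriction[OF measure_over_hausdorff borel_measure_hausdorff])
  have emN: "emeasure ?N B = \<mu> B" if "B \<in> sets borel" for B
    using that by (rule emeasure_borel_restriction[OF mo bm])
  have atomless: "\<mu> {x} = 0" if "x \<in> A" for x
    using that by (intro ac) (auto simp: hausdorff_measure_singleton)
  obtain \<U> where \<U>: "countable \<U>" "A \<subseteq> \<Union>\<U>" "\<And>U. U \<in> \<U> \<Longrightarrow> open U \<and> \<mu> U < \<infinity>"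
    using assms(8) by blast
  \<comment> \<open>The added empty set makes the family nonempty, as its enumeration by
    \<open>from_nat_into\<close> requires.\<close>
  define u where "u = from_nat_into (insert {} \<U>)"
  have range_u: "range u = insert {} \<U>"
    unfolding u_def using \<U>(1) by (intro range_from_nat_into) auto
  have u: "open (u n)" "\<mu> (u n) < \<infinity>" for n
  proof -
    have "u n \<in> insert {} \<U>" using range_u by blast
    then show "open (u n)" "\<mu> (u n) < \<infinity>" using \<U>(3) by (auto simp: measure_over_empty[OF mo])
  qed
  have A_u: "A \<subseteq> (\<Union>n. u n)" using \<U>(2) range_u by auto
  \<comment> \<open>Outer regularity asks for an open set of finite measure around \<open>B\<close>.
    The sets \<open>u n\<close> provide it, and \<open>lower\<close> then sums over disjoint
    pieces.\<close>
  have local_lower: "ennreal s * ?H B \<le> \<mu> B"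
    if B: "B \<in> sets borel" "B \<subseteq> A \<inter> u n" and s: "0 < s" and gt: "\<And>x. x \<in> B \<Longrightarrow> ennreal s < ?d x" for B s n
  proof -
    have "ennreal s * ?H B \<le> emeasure ?N B"
    proof (rule outer_regular_borel[OF sets_borel_restriction])
      show "open (u n)" "emeasure ?N (u n) < \<infinity>" "B \<subseteq> u n" using u[of n] B by (auto simp: emN)
      fix V assume V: "open V" "B \<subseteq> V" "V \<subseteq> u n"
      have "\<mu> V < \<infinity>" using measure_over_mono[OF mo V(3)] u(2)[of n] by (rule le_less_trans)
      then have "ennreal s * ?H B \<le> \<mu> V"
        using B gt by (intro hausdorff_measure_le_open[OF mo bm c \<alpha> s V(1,2)] atomless) auto
      then show "ennreal s * ?H B \<le> emeasure ?N V" using V by (simp add: emN)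
    qed (rule B(1))
    then show ?thesis using B by (simp add: emN)
  qed
  have lower: "ennreal s * ?H B \<le> \<mu> B"
    if B: "B \<in> sets borel" "B \<subseteq> A" and s: "0 < s" and gt: "\<And>x. x \<in> B \<Longrightarrow> ennreal s < ?d x" for B s
  proof -
    define P where "P n = B \<inter> disjointed u n" for n
    have P: "P n \<in> sets borel" "P n \<subseteq> A \<inter> u n" for n
    proof -
      have "disjointed u n \<in> sets borel"
        using u(1) by (intro sets.range_disjointed_sets[THEN subsetD, of u]) auto
      then show "P n \<in> sets borel" using B by (simp add: P_def)
      show "P n \<subseteq> A \<inter> u n" using B disjointed_subset[of u n] by (auto simp: P_def)
    qed
    have disj: "disjoint_family P"
      using disjoint_family_disjointed[of u] by (auto simp: disjoint_family_on_def P_def)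
    have "(\<Union>n. P n) = B"
      using A_u B UN_disjointed_eq[of u] by (auto simp: P_def)
    then have sum: "(\<Sum>n. emeasure Q (P n)) = emeasure Q B" if "sets Q = sets borel" for Q
      using P disj that suminf_emeasure[of P Q] by auto
    have "ennreal s * ?H B = (\<Sum>n. ennreal s * ?H (P n))"
      using sum[of ?M] P B by (simp add: emM)
    also have "\<dots> \<le> (\<Sum>n. \<mu> (P n))"
      using P s gt by (intro suminf_le local_lower) (auto simp: P_def)
    also have "\<dots> = \<mu> B"
      using sum[of ?N] P B by (simp add: emN)
    finally show ?thesis .
  qed
  \<comment> \<open>Here sigma-finiteness enters: on each covering set \<mu> is at most
    \<open>s\<close> times a finite Hausdorff measure, for every \<open>s > 0\<close>.\<close>
  have zero: "\<mu> {x\<in>A. ?d x = 0} = 0"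
  proof -
    let ?Z = "{x\<in>A. ?d x = 0}"
    obtain \<E> where \<E>: "countable \<E>" "?Z \<subseteq> \<Union>\<E>" "\<And>P. P \<in> \<E> \<Longrightarrow> ?H P < \<infinity>"
      using assms(9) by (auto simp: sigma_finite_wrt_def)
    have "\<mu> (?Z \<inter> P) = 0" if "P \<in> \<E>" for P
    proof (rule ennreal_eq_0_if_le_small_multiples[OF \<E>(3)[OF that]])
      fix s :: real assume s: "0 < s"
      have "\<mu> (?Z \<inter> P) \<le> ennreal s * ?H (?Z \<inter> P)"
        using s by (intro measure_le_hausdorff_measure[OF mo reg c s]) auto
      also have "\<dots> \<le> ennreal s * ?H P"
        by (intro mult_left_mono measure_over_mono[OF measure_over_hausdorff]) auto
      finally show "\<mu> (?Z \<inter> P) \<le> ennreal s * ?H P" .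
    qed
    then have "\<mu> (\<Union>P\<in>\<E>. ?Z \<inter> P) = 0"
      by (rule measure_over_UN_zero[OF mo \<E>(1)])
    moreover have "(\<Union>P\<in>\<E>. ?Z \<inter> P) = ?Z" using \<E>(2) by blast
    ultimately show ?thesis by simp
  qed
  have inf: "?H {x\<in>A. ?d x = \<infinity>} = 0"
  proof -
    let ?I = "{x\<in>A. ?d x = \<infinity>}"
    have "?H (?I \<inter> u n) = 0" for n
    proof (rule ennreal_eq_0_if_le_small_multiples[OF u(2)])
      fix s :: real assume s: "0 < s"
      \<comment> \<open>The density exceeds \<open>1 / s\<close> for every \<open>s > 0\<close>, and
        \<mu> is finite on \<open>u n\<close>, so the Hausdorff measure must vanish.\<close>
      have "ennreal (1 / s) * ?H (?I \<inter> u n) \<le> \<mu> (u n)"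
        using s u by (intro hausdorff_measure_le_open[OF mo bm c \<alpha>] atomless) auto
      then show "?H (?I \<inter> u n) \<le> ennreal s * \<mu> (u n)"
        by (simp add: ennreal_le_mult_iff[OF s])
    qed
    then have "?H (\<Union>n. ?I \<inter> u n) = 0"
      by (intro measure_over_UN_zero[OF measure_over_hausdorff]) auto
    moreover have "(\<Union>n. ?I \<inter> u n) = ?I" using A_u by blast
    ultimately show ?thesis by simp
  qed
  have "\<mu> B = (\<integral>\<^sup>+ x\<in>B. ?d x \<partial>caratheodory_measure ?H)" if B: "B \<in> sets borel" "B \<subseteq> A" for B
  proof -
    have B_restr: "{x\<in>B. ?d x = 0} \<in> sets borel" "{x\<in>B. ?d x = \<infinity>} \<in> sets borel"
    proof -
      have "{x\<in>B. ?d x = y} \<in> sets borel" for y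
      proof -
        have "{x\<in>B. ?d x = y} = B \<inter> (?d -` {y} \<inter> space borel)" by auto
        also have "\<dots> \<in> sets borel" using B(1) measurable_sets[OF d, of "{y}"] by auto
        finally show ?thesis .
      qed
      then show "{x\<in>B. ?d x = 0} \<in> sets borel" "{x\<in>B. ?d x = \<infinity>} \<in> sets borel" by blast+
    qed
    have "\<mu> {x\<in>B. ?d x = 0} \<le> \<mu> {x\<in>A. ?d x = 0}" "?H {x\<in>B. ?d x = \<infinity>} \<le> ?H {x\<in>A. ?d x = \<infinity>}"
      using B(2) by (auto intro!: measure_over_mono mo measure_over_hausdorff)
    then have null: "\<mu> {x\<in>B. ?d x = 0} = 0" "?H {x\<in>B. ?d x = \<infinity>} = 0"
      using zero inf by simp_all
    have null': "\<mu> {x\<in>B. ?d x = \<infinity>} = 0"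
      using B(2) null(2) by (intro ac) auto
    have "\<mu> B = emeasure ?N B" using B by (simp add: emN)
    also have "\<dots> = emeasure (density ?M ?d) B"
    proof (rule emeasure_eq_density_if_level_bounds)
      show "sets ?N = sets ?M" by simp
      show "?d \<in> borel_measurable ?M" using d by (simp add: measurable_cong_sets[OF sets_borel_restriction refl])
      show "B \<in> sets ?M" using B by simp
      show "emeasure ?N {x\<in>B. ?d x = 0} = 0" "emeasure ?N {x\<in>B. ?d x = \<infinity>} = 0"
        "emeasure ?M {x\<in>B. ?d x = \<infinity>} = 0"
        using B_restr null null' by (simp_all only: emN emM)
    next
      fix C and s :: real
      assume C: "C \<in> sets ?M" "C \<subseteq> B" and s: "0 < s" and lt: "\<And>x. x \<in> C \<Longrightarrow> ?d x < ennreal s"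
      then show "emeasure ?N C \<le> ennreal s * emeasure ?M C"
        using measure_le_hausdorff_measure[OF mo reg c s lt] by (simp add: emM emN)
    next
      fix C and s :: real
      assume C: "C \<in> sets ?M" "C \<subseteq> B" and s: "0 < s" and gt: "\<And>x. x \<in> C \<Longrightarrow> ennreal s < ?d x"
      then show "ennreal s * emeasure ?M C \<le> emeasure ?N C"
        using lower[OF _ _ s gt] B(2) by (auto simp: emM emN)
    qed
    also have "\<dots> = (\<integral>\<^sup>+ x. ?d x * indicator B x \<partial>?M)"
      using B d by (intro emeasure_density) (simp_all add: measurable_cong_sets[OF sets_borel_restriction refl])
    \<comment> \<open>For a Borel integrand the restriction and the full Caratheodory measure give
      the same integral.\<close>
    also have "\<dots> = (\<integral>\<^sup>+ x\<in>B. ?d x \<partial>caratheodory_measure ?H)"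
      using B(1) by (intro nn_integral_borel_restriction measure_over_hausdorff borel_measure_hausdorff
        borel_measurable_times_ennreal borel_measurable_indicator d)
    finally show ?thesis .
  qed
  then show ?thesis using d by (auto intro: measurable_restrict_space1)
qed

end
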